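(* Let the kernel, domain and scaling assumptions stated in the context hold for the parameters $\delta_n,h,\varepsilon>0$. Let $\mathbf u_n:\Omega_n\to\mathbb R$ solve the graph infinity Laplacian equation with labels $\mathbf g_n:\mathcal O_n\to\mathbb R$ on $\mathcal O_n$. Then there exists a constant $C>0$ (not depending on $n,\delta_n,h,\varepsilon$) such that for all $x_0\in\overline\Omega$ with $\operatorname{dist}_\Omega(x_0,\mathcal O)>2\varepsilon+3\delta_n$ it holds $$-\Delta_\infty^\varepsilon u_n^\varepsilon(x_0)\le \operatorname{Lip}_n(\mathbf g_n)\,C\left(\frac{\delta_n}{h\varepsilon}+\frac h{\varepsilon^2}+\frac{\phi(h)}{h\varepsilon}\right),$$ $$-\Delta_\infty^\varepsilon (u_n)_\varepsilon(x_0)\ge -\operatorname{Lip}_n(\mathbf g_n)\,C\left(\frac{\delta_n}{h\varepsilon}+\frac h{\varepsilon^2}+\frac{\phi(h)}{h\varepsilon}\right).$$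
   Context: Notation: $a\vee b=\max\{a,b\}$, $|\cdot|$ is the Euclidean norm. Domain. $\Omega\subset\mathbb R^d$ is an open bounded domain, and $d_\Omega(x,y)=\inf\{\int_0^1|\dot\xi(t)|\,dt:\ \xi\in C^1([0,1];\overline\Omega),\ \xi(0)=x,\ \xi(1)=y\}$ for $x,y\in\overline\Omega$. $\operatorname{dist}_\Omega(x,A)=\inf_{y\in A}d_\Omega(x,y)$; $\overline B_\Omega(x,\varepsilon)$ is the closure of the geodesic ball $B_\Omega(x,\varepsilon)=\{y\in\overline\Omega: d_\Omega(x,y)<\varepsilon\}$. Domain assumption: there are $\phi:[0,\infty)\to[0,\infty)$ with $\lim_{h\downarrow0}\phi(h)/h=0$ and $r_\Omega>0$ such that $d_\Omega(x,y)\le|x-y|+\phi(|x-y|)$ for all $x,y\in\Omega$ with $|x-y|\le r_\Omega$. Set $\sigma_\phi(h)=\sup_{0<s\le h}\phi(s)/s$. Labels and point clouds. $\mathcal O\subset\overline\Omega$ is nonempty and closed. For $n\in\mathbb N$, $\Omega_n\subset\overline\Omega$ is a finite point cloud and $\mathcal O_n\subset\Omega_n$ is nonempty. With $d_H(A,B)=\sup_{x\in A}\inf_{y\in B}|x-y|\vee\sup_{x\in B}\inf_{y\in A}|x-y|$, the graph resolution is $\delta_n=d_H(\Omega_n,\overline\Omega)\vee d_H(\mathcal O_n,\mathcal O)$. Kernel assumption: $\eta:(0,\infty)\to[0,\infty)$ is nonincreasing with $\operatorname{supp}\eta\subset[0,1]$, $\sigma_\eta:=\sup_{t>0}t\eta(t)\in(0,\infty)$,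 and there exists $t_0\in(0,1]$ (chosen as the largest number with this property) with $\sigma_\eta=t_0\eta(t_0)$. Graph. Weights on $\Omega_n$: $\mathbf w_n(\mathbf x,\mathbf y)=\frac1{\sigma_\eta h}\eta\left(\frac{|\mathbf x-\mathbf y|}h\right)$ for $\mathbf x\ne\mathbf y$ and $0$ for $\mathbf x=\mathbf y$. Graph distance: $\mathbf d_n(\mathbf x,\mathbf x)=0$ and, for $\mathbf x\ne\mathbf y$, $\mathbf d_n(\mathbf x,\mathbf y)=\min\{\sum_{i=1}^N\mathbf w_n(\mathbf x_{i-1},\mathbf x_i)^{-1}\}$ over all $N\in\mathbb N$ and finite sequences in $\Omega_n$ with $\mathbf x_0=\mathbf x$, $\mathbf x_N=\mathbf y$ (with $0^{-1}=\infty$). $\operatorname{Lip}_n(\mathbf g_n)=\max_{\mathbf x\neq\mathbf y\in\mathcal O_n}|\mathbf g_n(\mathbf x)-\mathbf g_n(\mathbf y)|/\mathbf d_n(\mathbf x,\mathbf y)$. Graph infinity Laplacian equation: $\min_{\mathbf y\in\Omega_n}\mathbf w_n(\mathbf x,\mathbf y)(\mathbf u_n(\mathbf y)-\mathbf u_n(\mathbf x))+\max_{\mathbf y\in\Omega_n}\mathbf w_n(\mathbf x,\mathbf y)(\mathbf u_n(\mathbf y)-\mathbf u_n(\mathbf x))=0$ for $\mathbf x\in\Omega_n\setminus\mathcal O_n$, and $\mathbf u_n=\mathbf g_n$ on $\mathcal O_n$. Extensions: for $x\in\overline\Omega$, $u_n^\varepsilon(x)=\sup_{\overline B_\Omega(x,\varepsilon)\cap\Omega_n}\mathbf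 u_n$ and $(u_n)_\varepsilon(x)=\inf_{\overline B_\Omega(x,\varepsilon)\cap\Omega_n}\mathbf u_n$. Nonlocal infinity Laplacian: for $v:\overline\Omega\to\mathbb R$, $\Delta_\infty^\varepsilon v(x)=\frac1{\varepsilon^2}\left(\sup_{\overline B_\Omega(x,\varepsilon)}v+\inf_{\overline B_\Omega(x,\varepsilon)}v-2v(x)\right)$. Scaling assumption on $(\delta_n,h,\varepsilon)$: $h\le r_\Omega$, $\ \frac h\varepsilon<\frac12$, $\ \sigma_\phi(h)+\frac{\delta_n}h\le\frac{t_0}{4+2\sigma_\phi(h)}\left(1-2\frac h\varepsilon\right)$. Constants: $C$ may depend on the domain ($\Omega,\phi,r_\Omega$) and the kernel $\eta$. *)

theory Defs
  imports "HOL-Analysis.Analysis"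
begin

(* d_Omega takes values in [0,infinity]: it is infinity if no admissible curve exists.
   At the endpoints of [0,1] the derivative is the one-sided one. *)
definition geo_dist :: "'a::euclidean_space set \<Rightarrow> 'a \<Rightarrow> 'a \<Rightarrow> ennreal" where
  "geo_dist \<Omega> x y =
     Inf {ennreal (integral {0..1} (\<lambda>t. norm (\<xi>' t))) | \<xi> \<xi>' :: real \<Rightarrow> 'a.
            (\<forall>t\<in>{0..1}. (\<xi> has_vector_derivative \<xi>' t) (at t within {0..1})) \<and>
            continuous_on {0..1} \<xi>' \<and> \<xi> ` {0..1} \<subseteq> closure \<Omega> \<and> \<xi> 0 = x \<and> \<xi> 1 = y}"

definition geo_setdist :: "'a::euclidean_space set \<Rightarrow> 'a \<Rightarrow> 'a set \<Rightarrow> ennreal" where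
  "geo_setdist \<Omega> x A = (INF y\<in>A. geo_dist \<Omega> x y)"

definition geo_ball :: "'a::euclidean_space set \<Rightarrow> 'a \<Rightarrow> real \<Rightarrow> 'a set" where
  "geo_ball \<Omega> x \<epsilon> = {y \<in> closure \<Omega>. geo_dist \<Omega> x y < ennreal \<epsilon>}"

definition geo_cball :: "'a::euclidean_space set \<Rightarrow> 'a \<Rightarrow> real \<Rightarrow> 'a set" where
  "geo_cball \<Omega> x \<epsilon> = closure (geo_ball \<Omega> x \<epsilon>)"

definition domain_assumption ::
  "'a::euclidean_space set \<Rightarrow> (real \<Rightarrow> real) \<Rightarrow> real \<Rightarrow> bool" where
  "domain_assumption \<Omega> \<phi> r \<longleftrightarrow>
     (\<forall>s\<ge>0. 0 \<le> \<phi> s) \<and> ((\<lambda>s. \<phi> s / s) \<longlongrightarrow> 0) (at_right 0) \<and> 0 < r \<and>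
     (\<forall>x\<in>\<Omega>. \<forall>y\<in>\<Omega>. norm (x - y) \<le> r \<longrightarrow>
        geo_dist \<Omega> x y \<le> ennreal (norm (x - y) + \<phi> (norm (x - y))))"

definition sigma_phi :: "(real \<Rightarrow> real) \<Rightarrow> real \<Rightarrow> real" where
  "sigma_phi \<phi> h = (SUP s\<in>{0<..h}. \<phi> s / s)"

definition hausdorff_dist :: "'a::euclidean_space set \<Rightarrow> 'a set \<Rightarrow> real" where
  "hausdorff_dist A B =
     max (SUP x\<in>A. INF y\<in>B. norm (x - y)) (SUP x\<in>B. INF y\<in>A. norm (x - y))"

definition resolution ::
  "'a::euclidean_space set \<Rightarrow> 'a set \<Rightarrow> 'a set \<Rightarrow> 'a set \<Rightarrow> real" where
  "resolution \<Omega> O\<^sub>0 \<Omega>n On = max (hausdorff_dist \<Omega>n (closure \<Omega>)) (hausdorff_dist On O\<^sub>0)"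

definition sigma_eta :: "(real \<Rightarrow> real) \<Rightarrow> real" where
  "sigma_eta \<eta> = (SUP t\<in>{0<..}. t * \<eta> t)"

(* Only the values of the kernel on (0,infinity) matter. The boundedness clause says that
   the supremum sigma_eta is finite; t0 is the largest maximiser of t * eta(t) in (0,1]. *)
definition kernel_assumption :: "(real \<Rightarrow> real) \<Rightarrow> real \<Rightarrow> bool" where
  "kernel_assumption \<eta> t0 \<longleftrightarrow>
     (\<forall>t>0. 0 \<le> \<eta> t) \<and> (\<forall>s t. 0 < s \<and> s \<le> t \<longrightarrow> \<eta> t \<le> \<eta> s) \<and> (\<forall>t>1. \<eta> t = 0) \<and>
     bdd_above ((\<lambda>t. t * \<eta> t) ` {0<..}) \<and> 0 < sigma_eta \<eta> \<and>
     0 < t0 \<and> t0 \<le> 1 \<and> sigma_eta \<eta> = t0 * \<eta> t0 \<and>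
     (\<forall>t. 0 < t \<and> t \<le> 1 \<and> sigma_eta \<eta> = t * \<eta> t \<longrightarrow> t \<le> t0)"

definition graph_weight :: "(real \<Rightarrow> real) \<Rightarrow> real \<Rightarrow> 'a::euclidean_space \<Rightarrow> 'a \<Rightarrow> real" where
  "graph_weight \<eta> h x y =
     (if x = y then 0 else 1 / (sigma_eta \<eta> * h) * \<eta> (norm (x - y) / h))"

(* In ennreal, inverse 0 is infinity, so a path using a missing edge has infinite length. *)
definition graph_dist ::
  "(real \<Rightarrow> real) \<Rightarrow> real \<Rightarrow> 'a::euclidean_space set \<Rightarrow> 'a \<Rightarrow> 'a \<Rightarrow> ennreal" where
  "graph_dist \<eta> h \<Omega>n x y =
     (if x = y then 0
      else Inf {\<Sum>i=1..N. inverse (ennreal (graph_weight \<eta> h (p (i - 1)) (p i))) | (N::nat) p.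
                  1 \<le> N \<and> (\<forall>i\<le>N. p i \<in> \<Omega>n) \<and> p 0 = x \<and> p N = y})"

(* A difference quotient with infinite graph distance is 0. Inserting 0 fixes the value of
   the empty maximum (a single label) and changes nothing otherwise. *)
definition graph_Lip ::
  "(real \<Rightarrow> real) \<Rightarrow> real \<Rightarrow> 'a::euclidean_space set \<Rightarrow> 'a set \<Rightarrow> ('a \<Rightarrow> real) \<Rightarrow> real" where
  "graph_Lip \<eta> h \<Omega>n On g =
     Max (insert 0 {enn2real (ennreal \<bar>g x - g y\<bar> / graph_dist \<eta> h \<Omega>n x y) | x y.
                      x \<in> On \<and> y \<in> On \<and> x \<noteq> y})"

definition solves_graph_inf_laplace ::
  "(real \<Rightarrow> real) \<Rightarrow> real \<Rightarrow> 'a::euclidean_space set \<Rightarrow> 'a set \<Rightarrow> ('a \<Rightarrow> real) \<Rightarrow> ('a \<Rightarrow> real) \<Rightarrow> bool"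
  where
  "solves_graph_inf_laplace \<eta> h \<Omega>n On g u \<longleftrightarrow>
     (\<forall>x\<in>\<Omega>n - On.
        Min ((\<lambda>y. graph_weight \<eta> h x y * (u y - u x)) ` \<Omega>n) +
        Max ((\<lambda>y. graph_weight \<eta> h x y * (u y - u x)) ` \<Omega>n) = 0) \<and>
     (\<forall>x\<in>On. u x = g x)"

definition upper_ext ::
  "'a::euclidean_space set \<Rightarrow> 'a set \<Rightarrow> real \<Rightarrow> ('a \<Rightarrow> real) \<Rightarrow> 'a \<Rightarrow> real" where
  "upper_ext \<Omega> \<Omega>n \<epsilon> u x = (SUP y\<in>geo_cball \<Omega> x \<epsilon> \<inter> \<Omega>n. u y)"

definition lower_ext ::
  "'a::euclidean_space set \<Rightarrow> 'a set \<Rightarrow> real \<Rightarrow> ('a \<Rightarrow> real) \<Rightarrow> 'a \<Rightarrow> real" where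
  "lower_ext \<Omega> \<Omega>n \<epsilon> u x = (INF y\<in>geo_cball \<Omega> x \<epsilon> \<inter> \<Omega>n. u y)"

definition nonlocal_inf_laplacian ::
  "'a::euclidean_space set \<Rightarrow> real \<Rightarrow> ('a \<Rightarrow> real) \<Rightarrow> 'a \<Rightarrow> real" where
  "nonlocal_inf_laplacian \<Omega> \<epsilon> v x =
     1 / \<epsilon>\<^sup>2 * ((SUP y\<in>geo_cball \<Omega> x \<epsilon>. v y) + (INF y\<in>geo_cball \<Omega> x \<epsilon>. v y) - 2 * v x)"

(* The boundedness clause says that sigma_phi(h), a supremum that may be infinite, is finite,
   which the last inequality of the scaling assumption presupposes. *)
definition scaling_assumption ::
  "(real \<Rightarrow> real) \<Rightarrow> real \<Rightarrow> real \<Rightarrow> real \<Rightarrow> real \<Rightarrow> real \<Rightarrow> bool" where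
  "scaling_assumption \<phi> r t0 \<delta> h \<epsilon> \<longleftrightarrow>
     h \<le> r \<and> h / \<epsilon> < 1 / 2 \<and> bdd_above ((\<lambda>s. \<phi> s / s) ` {0<..h}) \<and>
     sigma_phi \<phi> h + \<delta> / h \<le> t0 / (4 + 2 * sigma_phi \<phi> h) * (1 - 2 * (h / \<epsilon>))"

end

theory Submission
  imports Defs
begin

text \<open>
The proof follows the argument for the continuum equation: a function that lies below cones
satisfies \<^term>\<open>2 * U x \<le> S + I\<close>, where \<^term>\<open>U\<close> is its supremum over the \<open>\<epsilon>\<close>-ball and \<^term>\<open>S\<close>, \<^term>\<open>I\<close> are the
supremum and infimum of \<^term>\<open>U\<close> over that ball. On the graph, let \<open>c\<close> be a vertex next to \<open>x\<^sub>0\<close>, and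
put at \<open>c\<close> the cone of the graph distance whose slope makes it at least \<open>S\<close> on every vertex at
geodesic distance about \<open>2 * \<epsilon>\<close>. The solution lies below this cone (\<open>cone_comparison\<close>), in
particular at the vertex where \<open>U x\<^sub>0\<close> is attained, which is within \<open>\<epsilon>\<close>. If the graph distance were
the geodesic distance, this would be the inequality above, because \<open>I\<close> is at least \<open>u c\<close> up to a
small error. So the defect is the product of \<open>S - u c\<close>, which is of order \<open>\<epsilon>\<close> times the Lipschitz
constant of the labels (\<open>solution_lipschitz\<close>), and the relative error between the two distances at
scale \<open>\<epsilon>\<close>.

From above, the graph distance is compared with the geodesic distance by placing vertices along a
nearly shortest curve at spacing \<open>t\<^sub>0 * h - 2 * \<delta>\<close>: an edge of length at most \<open>t\<^sub>0 * h\<close> costs at most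
\<open>t\<^sub>0 * h\<close> (\<open>egdist_upper\<close>). This gives the relative error \<open>\<delta> / h\<close> and the absolute error \<open>h\<close>.

From below, every edge costs at least its Euclidean length, but its segment may leave the domain.
Bounding each edge separately by the domain assumption would give the relative error
\<open>sup {\<phi> s / s | s \<le> h}\<close>, which \<open>\<phi> h / h\<close> does not control. Instead, consider a jump from \<open>z\<close> to \<open>z'\<close> of
length at most \<open>h\<close> on the way to \<open>y\<close>. A nearly shortest curve from \<open>z'\<close> to \<open>y\<close> meets the sphere of radius
\<open>h\<close> about \<open>z\<close> at some \<open>p\<close>. One may go from \<open>z\<close> directly to \<open>p\<close> with length \<open>h + \<phi> h\<close>, and \<open>h\<close> is at most the
length of the jump plus that of the piece from \<open>z'\<close> to \<open>p\<close>. Hence each jump loses at most \<open>\<phi> h\<close>,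
however short it is (\<open>rdist_jump\<close>). Consecutive short jumps can be replaced by one, so that a
chain of length \<open>L\<close> needs only of the order of \<open>L / h\<close> jumps (\<open>rdist_le_chain_length\<close>).

Two points need care, because the domain assumption concerns points of the open set only, while
vertices may lie on its boundary. First, a boundary point is reached from inside by infinitely
many curves whose concatenation must be continuously differentiable (\<open>geo_dist_limit_le\<close>). Second,
an edge of length exactly \<open>h\<close> may join two boundary points that face each other across a wall of
thickness \<open>h\<close>, and then no pair of interior points at distance \<open>h\<close> is near it (the last case of
\<open>rdist_jump\<close>). That case is settled only for \<open>h\<close> below a threshold \<open>h\<^sub>0\<close> that depends on \<open>\<phi>\<close>. For
\<open>h \<ge> h\<^sub>0\<close> the estimate follows from a bound on the oscillation of the solution by the geodesic
diameter; this is where the constant depends on the domain.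

The second inequality is the first one for the negative of the solution.
\<close>

section \<open>Curves of speed at most one\<close>

text \<open>
A form of admissible curves that is easy to concatenate, even infinitely often: lengths are measured
by elapsed time instead of integrals, and since a curve is constant before time 0 and after time \<open>l\<close>,
two of them join with a continuous derivative.
\<close>

definition joined_within :: "'a::euclidean_space set \<Rightarrow> 'a \<Rightarrow> 'a \<Rightarrow> real \<Rightarrow> bool" where
  "joined_within X x y l \<longleftrightarrow>
     (\<exists>c c'. (\<forall>t. (c has_vector_derivative c' t) (at t)) \<and> continuous_on UNIV c' \<and>
        (\<forall>t. norm (c' t) \<le> 1) \<and> (\<forall>t. c t \<in> X) \<and> (\<forall>t\<le>0. c t = x) \<and> (\<forall>t\<ge>l. c t = y))"

lemma has_field_derivative_positive_part_squared:
  fixes t a :: real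
  shows "((\<lambda>t. (max 0 (t - a))\<^sup>2) has_field_derivative 2 * max 0 (t - a)) (at t)"
proof -
  consider "t < a" | "t = a" | "a < t" by linarith
  then show ?thesis
  proof cases
    case 1
    have "((\<lambda>t. 0) has_field_derivative 2 * max 0 (t - a)) (at t)"
      using 1 by (auto intro!: derivative_eq_intros)
    then show ?thesis
      by (rule has_field_derivative_transform_within_open[where S = "{..<a}"]) (use 1 in auto)
  next
    case 2
    have "((\<lambda>h. (max 0 (h::real))\<^sup>2 / h) \<longlongrightarrow> 0) (at 0)"
    proof (rule Lim_null_comparison[where g = "\<lambda>h. \<bar>h\<bar>"])
      show "\<forall>\<^sub>F h in at 0. norm ((max 0 (h::real))\<^sup>2 / h) \<le> \<bar>h\<bar>"
        by (rule always_eventually) (auto simp: max_def power2_eq_square)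
      show "((\<lambda>h. \<bar>h\<bar>) \<longlongrightarrow> (0::real)) (at 0)"
        using tendsto_rabs[OF tendsto_ident_at[of 0 UNIV]] by simp
    qed
    then show ?thesis using 2 by (simp add: DERIV_def)
  next
    case 3
    have "((\<lambda>t. (t - a)\<^sup>2) has_field_derivative 2 * max 0 (t - a)) (at t)"
      using 3 by (auto intro!: derivative_eq_intros)
    then show ?thesis
      by (rule has_field_derivative_transform_within_open[where S = "{a<..}"]) (use 3 in auto)
  qed
qed

text \<open>
A monotone step from 0 to 1 whose derivative is the hat function on the unit interval.
Composing a curve with it makes the velocity vanish at both ends.
\<close>

definition smooth_step :: "real \<Rightarrow> real" where
  "smooth_step t = 2 * ((max 0 (t - 0))\<^sup>2 - 2 * (max 0 (t - 1/2))\<^sup>2 + (max 0 (t - 1))\<^sup>2)"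

definition smooth_step_deriv :: "real \<Rightarrow> real" where
  "smooth_step_deriv t = 4 * (max 0 (t - 0) - 2 * max 0 (t - 1/2) + max 0 (t - 1))"

lemma smooth_step_has_derivative:
  "(smooth_step has_field_derivative smooth_step_deriv t) (at t)"
  unfolding smooth_step_def smooth_step_deriv_def
  by (rule derivative_eq_intros has_field_derivative_positive_part_squared refl | simp)+

lemma smooth_step_deriv_nonneg: "0 \<le> smooth_step_deriv t"
  unfolding smooth_step_deriv_def by (auto simp: max_def)

lemma continuous_smooth_step_deriv: "continuous_on S smooth_step_deriv"
  unfolding smooth_step_deriv_def by (intro continuous_intros)

lemma smooth_step_le_0: "t \<le> 0 \<Longrightarrow> smooth_step t = 0"
  unfolding smooth_step_def by (auto simp: max_def)

lemma smooth_step_ge_1: "1 \<le> t \<Longrightarrow> smooth_step t = 1"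
  unfolding smooth_step_def by (auto simp: max_def power2_eq_square algebra_simps)

lemma smooth_step_mono: "s \<le> t \<Longrightarrow> smooth_step s \<le> smooth_step t"
  by (erule DERIV_nonneg_imp_nondecreasing)
     (blast intro: smooth_step_has_derivative smooth_step_deriv_nonneg)

lemma smooth_step_range: "smooth_step t \<in> {0..1}"
proof -
  have "smooth_step (min t 0) \<le> smooth_step t" "smooth_step t \<le> smooth_step (max t 1)"
    by (rule smooth_step_mono; simp)+
  then show ?thesis by (simp add: smooth_step_le_0 smooth_step_ge_1)
qed

text \<open>
The curve is first slowed down to rest at its ends and then parametrised by arc length plus
a small multiple of time. The extra term keeps the reparametrisation invertible where the velocity
vanishes, and it uses up exactly the difference between \<open>l\<close> and the length of the curve.
\<close>

lemma joined_within_if_geo_dist_less: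
  assumes "geo_dist \<Omega> x y < ennreal l"
  shows "joined_within (closure \<Omega>) x y l"
proof -
  from assms obtain \<xi> \<xi>' :: "real \<Rightarrow> 'a" where
    der: "\<And>t. t \<in> {0..1} \<Longrightarrow> (\<xi> has_vector_derivative \<xi>' t) (at t within {0..1})"
    and cont: "continuous_on {0..1} \<xi>'" and im: "\<xi> ` {0..1} \<subseteq> closure \<Omega>"
    and ends: "\<xi> 0 = x" "\<xi> 1 = y"
    and len: "ennreal (integral {0..1} (\<lambda>t. norm (\<xi>' t))) < ennreal l"
    unfolding geo_dist_def Inf_less_iff by blast
  define G where "G s = integral {0..s} (\<lambda>t. norm (\<xi>' t))" for s
  have contn: "continuous_on {0..1} (\<lambda>t. norm (\<xi>' t))" using cont by (rule continuous_on_norm)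
  have G1: "G 1 \<ge> 0" unfolding G_def by (rule integral_nonneg) (use contn integrable_continuous_real in auto)
  have derG: "(G has_vector_derivative norm (\<xi>' s)) (at s within {0..1})" if "s \<in> {0..1}" for s
    unfolding G_def using integral_has_vector_derivative[OF contn that] .
  \<comment> \<open>The total parameter time of the new curve is the length plus this number.\<close>
  define e where "e = l - G 1"
  have e: "e > 0" using len G1 unfolding e_def G_def by (simp add: ennreal_less_iff)
  define \<sigma> where "\<sigma> t = G (smooth_step t) + e * t" for t
  define \<sigma>' where "\<sigma>' t = smooth_step_deriv t * norm (\<xi>' (smooth_step t)) + e" for t
  define \<zeta> where "\<zeta> t = \<xi> (smooth_step t)" for t
  define \<zeta>' where "\<zeta>' t = smooth_step_deriv t *\<^sub>R \<xi>' (smooth_step t)" for t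
  have chain: "((\<lambda>t. f (smooth_step t)) has_vector_derivative
      smooth_step_deriv t *\<^sub>R f' (smooth_step t)) (at t)"
    if "\<And>s. s \<in> {0..1} \<Longrightarrow> (f has_vector_derivative f' s) (at s within {0..1})"
    for f f' :: "real \<Rightarrow> 'b::real_normed_vector" and t
  proof -
    have "(f has_vector_derivative f' (smooth_step t)) (at (smooth_step t) within range smooth_step)"
      by (rule has_vector_derivative_within_subset[OF that]) (use smooth_step_range in auto)
    then have "(f \<circ> smooth_step has_vector_derivative smooth_step_deriv t *\<^sub>R f' (smooth_step t)) (at t)"
      by (intro vector_diff_chain_within) 
         (simp_all add: smooth_step_has_derivative flip: has_real_derivative_iff_has_vector_derivative)
    then show ?thesis by (simp add: o_def)
  qed
  have d\<zeta>: "(\<zeta> has_vector_derivative \<zeta>' t) (at t)" for t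
    unfolding \<zeta>_def[abs_def] \<zeta>'_def by (rule chain[OF der])
  have "((\<lambda>t. G (smooth_step t)) has_vector_derivative
      smooth_step_deriv t *\<^sub>R norm (\<xi>' (smooth_step t))) (at t)" for t
    by (rule chain[OF derG])
  then have d\<sigma>: "(\<sigma> has_field_derivative \<sigma>' t) (at t)" for t
    unfolding \<sigma>_def[abs_def] \<sigma>'_def
    by (auto intro!: derivative_eq_intros simp flip: has_real_derivative_iff_has_vector_derivative)
  have contss: "continuous_on UNIV smooth_step"
    using smooth_step_has_derivative by (meson DERIV_isCont continuous_at_imp_continuous_on)
  have cont_c: "continuous_on UNIV (\<lambda>t. \<xi>' (smooth_step t))"
    by (rule continuous_on_compose2[OF cont contss]) (use smooth_step_range in auto)
  have \<sigma>'e: "\<sigma>' t \<ge> e" for t unfolding \<sigma>'_def by (simp add: smooth_step_deriv_nonneg)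
  have cont\<sigma>': "continuous_on UNIV \<sigma>'"
    unfolding \<sigma>'_def using cont_c continuous_smooth_step_deriv by (intro continuous_intros) auto
  have cont\<zeta>': "continuous_on UNIV \<zeta>'"
    unfolding \<zeta>'_def using cont_c continuous_smooth_step_deriv by (intro continuous_intros) auto
  have mono: "\<sigma> s < \<sigma> t" if "s < t" for s t
  proof (rule DERIV_pos_imp_increasing[OF that])
    fix u show "\<exists>a. DERIV \<sigma> u :> a \<and> 0 < a"
      using d\<sigma>[of u] \<sigma>'e[of u] e by (intro exI[of _ "\<sigma>' u"]) auto
  qed
  have cont\<sigma>: "continuous_on UNIV \<sigma>"
    using d\<sigma> by (meson DERIV_isCont continuous_at_imp_continuous_on)
  have surj: "\<exists>t. \<sigma> t = s" for s
  proof -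
    define T where "T = \<bar>s\<bar> / e + 1"
    have T: "T \<ge> 1" "e * T \<ge> \<bar>s\<bar>" using e by (auto simp: T_def field_simps)
    have "\<sigma> (- T) = - e * T" "\<sigma> T = G 1 + e * T" 
      unfolding \<sigma>_def using T by (auto simp: smooth_step_le_0 smooth_step_ge_1 G_def)
    then have "\<sigma> (-T) \<le> s" "s \<le> \<sigma> T" using T G1 by auto
    then show ?thesis 
      using IVT'[of \<sigma> "-T" s T] T continuous_on_subset[OF cont\<sigma>, of "{-T..T}"] by auto
  qed
  have inj: "s = t" if "\<sigma> s = \<sigma> t" for s t
    using mono[of s t] mono[of t s] that by (cases s t rule: linorder_cases) auto
  define \<tau> where "\<tau> s = (THE t. \<sigma> t = s)" for s
  have \<sigma>\<tau>: "\<sigma> (\<tau> s) = s" for s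
  proof -
    have "\<exists>!t. \<sigma> t = s" using surj[of s] inj by blast
    then show ?thesis unfolding \<tau>_def by (rule theI')
  qed
  have \<tau>\<sigma>: "\<tau> (\<sigma> t) = t" for t
    by (rule inj) (rule \<sigma>\<tau>)
  have cont\<tau>: "isCont \<tau> s" for s
    using isCont_inverse_function[of 1 "\<tau> s" \<tau> \<sigma>] \<tau>\<sigma> \<sigma>\<tau> cont\<sigma>
    by (simp add: continuous_on_eq_continuous_at)
  have d\<tau>: "(\<tau> has_field_derivative inverse (\<sigma>' (\<tau> s))) (at s)" for s
    by (rule DERIV_inverse_function[of \<sigma>, where a = "s - 1" and b = "s + 1"])
       (use d\<sigma> \<sigma>\<tau> cont\<tau> \<sigma>'e[of "\<tau> s"] e in auto)
  define c where "c s = \<zeta> (\<tau> s)" for s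
  define c' where "c' s = inverse (\<sigma>' (\<tau> s)) *\<^sub>R \<zeta>' (\<tau> s)" for s
  have dc: "(c has_vector_derivative c' s) (at s)" for s
  proof -
    have "(\<zeta> \<circ> \<tau> has_vector_derivative inverse (\<sigma>' (\<tau> s)) *\<^sub>R \<zeta>' (\<tau> s)) (at s)"
      by (rule vector_diff_chain_at) (use d\<tau> d\<zeta> in \<open>auto simp flip: has_real_derivative_iff_has_vector_derivative\<close>)
    then show ?thesis by (simp add: c_def[abs_def] c'_def o_def)
  qed
  have nz: "\<sigma>' t \<noteq> 0" for t using \<sigma>'e[of t] e by linarith
  have cont\<tau>U: "continuous_on UNIV \<tau>" using cont\<tau> by (simp add: continuous_at_imp_continuous_on)
  have cc': "continuous_on UNIV c'"
    unfolding c'_def using nz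
    by (intro continuous_intros continuous_on_compose2[OF cont\<sigma>' cont\<tau>U] continuous_on_compose2[OF cont\<zeta>' cont\<tau>U]) auto
  have "norm (c' s) \<le> 1" for s
  proof -
    have "norm (\<zeta>' (\<tau> s)) \<le> \<sigma>' (\<tau> s)"
      unfolding \<zeta>'_def \<sigma>'_def using e by (simp add: smooth_step_deriv_nonneg)
    then show ?thesis unfolding c'_def using \<sigma>'e[of "\<tau> s"] e by (simp add: field_simps)
  qed
  moreover have "c s \<in> closure \<Omega>" for s
    unfolding c_def \<zeta>_def using im smooth_step_range by blast
  moreover have "c s = x" if "s \<le> 0" for s
  proof -
    have "\<sigma> 0 = 0" by (simp add: \<sigma>_def smooth_step_le_0 G_def)
    then have "\<tau> s \<le> 0" using mono[of 0 "\<tau> s"] \<sigma>\<tau>[of s] that by linarith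
    then show ?thesis by (simp add: c_def \<zeta>_def smooth_step_le_0 ends)
  qed
  moreover have "c s = y" if "s \<ge> l" for s
  proof -
    have "\<sigma> 1 = l" by (simp add: \<sigma>_def smooth_step_ge_1 e_def)
    then have "\<tau> s \<ge> 1" using mono[of "\<tau> s" 1] \<sigma>\<tau>[of s] that by linarith
    then show ?thesis by (simp add: c_def \<zeta>_def smooth_step_ge_1 ends)
  qed
  ultimately show ?thesis unfolding joined_within_def using dc cc' by blast
qed

lemma geo_dist_le_along_curve:
  fixes c :: "real \<Rightarrow> 'a::euclidean_space"
  assumes der: "\<And>t. (c has_vector_derivative c' t) (at t)" and cont: "continuous_on UNIV c'"
    and speed: "\<And>t. norm (c' t) \<le> L" and im: "\<And>t. c t \<in> closure \<Omega>"
    and xy: "c a = x" "c b = y" and len: "L * \<bar>b - a\<bar> \<le> l"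
  shows "geo_dist \<Omega> x y \<le> ennreal l"
proof -
  define \<xi> where "\<xi> t = c (a + (b - a) * t)" for t
  define \<xi>' where "\<xi>' t = (b - a) *\<^sub>R c' (a + (b - a) * t)" for t
  have d: "(\<xi> has_vector_derivative \<xi>' t) (at t within {0..1})" for t
  proof -
    have "(c \<circ> (\<lambda>t. a + (b - a) * t) has_vector_derivative \<xi>' t) (at t)"
      unfolding \<xi>'_def
      by (rule vector_diff_chain_at) (auto intro!: derivative_eq_intros der)
    then show ?thesis by (simp add: \<xi>_def[abs_def] o_def has_vector_derivative_at_within)
  qed
  have c: "continuous_on {0..1} \<xi>'"
    unfolding \<xi>'_def by (intro continuous_intros continuous_on_compose2[OF cont]) auto
  have "integral {0..1} (\<lambda>t. norm (\<xi>' t)) \<le> integral {0..1} (\<lambda>t::real. l)"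
  proof (rule integral_le)
    show "(\<lambda>t. norm (\<xi>' t)) integrable_on {0..1}"
      by (intro integrable_continuous_real continuous_on_norm c)
    show "norm (\<xi>' t) \<le> l" for t
    proof -
      have "norm (\<xi>' t) \<le> \<bar>b - a\<bar> * L"
        unfolding \<xi>'_def by (simp add: mult_left_mono speed)
      then show ?thesis using len by (simp add: mult.commute)
    qed
  qed auto
  then have "ennreal (integral {0..1} (\<lambda>t. norm (\<xi>' t))) \<le> ennreal l" by (simp add: ennreal_leI)
  moreover have "geo_dist \<Omega> x y \<le> ennreal (integral {0..1} (\<lambda>t. norm (\<xi>' t)))"
    unfolding geo_dist_def
  proof (rule Inf_lower, rule CollectI, intro exI conjI)
    show "\<xi> ` {0..1} \<subseteq> closure \<Omega>" using im by (auto simp: \<xi>_def)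
  qed (use d c xy in \<open>auto simp: \<xi>_def\<close>)
  ultimately show ?thesis by order
qed

lemma geo_dist_le_if_joined:
  assumes "joined_within (closure \<Omega>) x y l" "0 \<le> l"
  shows "geo_dist \<Omega> x y \<le> ennreal l"
proof -
  obtain c c' where c: "\<And>t. (c has_vector_derivative c' t) (at t)" "continuous_on UNIV c'"
    "\<And>t. norm (c' t) \<le> 1" "\<And>t. c t \<in> closure \<Omega>" "\<And>t. t \<le> 0 \<Longrightarrow> c t = x" "\<And>t. t \<ge> l \<Longrightarrow> c t = y"
    using assms(1) unfolding joined_within_def by blast
  show ?thesis
    by (rule geo_dist_le_along_curve[OF c(1-4), where a = 0 and b = l]) (use c assms(2) in auto)
qed

lemma joined_within_trans:
  assumes "joined_within X x y l" "joined_within X y z m" and "0 \<le> l" "0 \<le> m"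
  shows "joined_within X x z (l + m)"
proof -
  obtain c c' where c: "\<And>t. (c has_vector_derivative c' t) (at t)" "continuous_on UNIV c'"
    "\<And>t. norm (c' t) \<le> 1" "\<And>t. c t \<in> X" "\<And>t. t \<le> 0 \<Longrightarrow> c t = x" "\<And>t. t \<ge> l \<Longrightarrow> c t = y"
    using assms(1) unfolding joined_within_def by blast
  obtain b b' where b: "\<And>t. (b has_vector_derivative b' t) (at t)" "continuous_on UNIV b'"
    "\<And>t. norm (b' t) \<le> 1" "\<And>t. b t \<in> X" "\<And>t. t \<le> 0 \<Longrightarrow> b t = y" "\<And>t. t \<ge> m \<Longrightarrow> b t = z"
    using assms(2) unfolding joined_within_def by blast
  \<comment> \<open>At every time one of the two summands is at rest, so the sum runs through both curves in turn and no
    gluing of derivatives at the junction is needed.\<close>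
  define f where "f t = c t + b (t - l) - y" for t
  define f' where "f' t = c' t + b' (t - l)" for t
  have "(f has_vector_derivative f' t) (at t)" for t
  proof -
    have "(b \<circ> (\<lambda>t. t - l) has_vector_derivative 1 *\<^sub>R b' (t - l)) (at t)"
      by (rule vector_diff_chain_at) (auto intro!: derivative_eq_intros b)
    then show ?thesis unfolding f_def[abs_def] f'_def o_def
      by (auto intro!: derivative_eq_intros c)
  qed
  moreover have "continuous_on UNIV f'"
    unfolding f'_def by (intro continuous_intros c continuous_on_compose2[OF b(2)]) auto
  moreover have "norm (f' t) \<le> 1" for t
  proof (cases "t \<le> l")
    case True
    have "b' (t - l) = 0"
    proof -
      have "(b has_vector_derivative b' (t-l)) (at (t-l) within {..t-l})"
        using b(1) has_vector_derivative_at_within by blast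
      moreover have "(b has_vector_derivative 0) (at (t-l) within {..t-l})"
        by (rule has_vector_derivative_transform[where f = "\<lambda>_. y"]) (use True b in auto)
      ultimately show ?thesis
        by (rule vector_derivative_unique_within[rotated]) (simp add: trivial_limit_at_left_real at_within_Iic_at_left)
    qed
    then show ?thesis by (simp add: f'_def c)
  next
    case False
    have "c' t = 0"
    proof -
      have "(c has_vector_derivative 0) (at t)"
        by (rule has_vector_derivative_transform_within_open[where f = "\<lambda>_. y" and S = "{l<..}"]) (use False c in auto)
      then show ?thesis using c(1) vector_derivative_unique_at by blast
    qed
    then show ?thesis by (simp add: f'_def b)
  qed
  moreover have "f t \<in> X" for t
    by (cases "t \<le> l") (use b c in \<open>auto simp: f_def\<close>)
  moreover have "f t = x" if "t \<le> 0" for t using that assms b c by (auto simp: f_def)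
  moreover have "f t = z" if "t \<ge> l + m" for t using that assms b c by (auto simp: f_def)
  ultimately show ?thesis unfolding joined_within_def by blast
qed

lemma joined_within_sym:
  assumes "joined_within X x y l" 
  shows "joined_within X y x l"
proof -
  obtain c c' where c: "\<And>t. (c has_vector_derivative c' t) (at t)" "continuous_on UNIV c'"
    "\<And>t. norm (c' t) \<le> 1" "\<And>t. c t \<in> X" "\<And>t. t \<le> 0 \<Longrightarrow> c t = x" "\<And>t. t \<ge> l \<Longrightarrow> c t = y"
    using assms(1) unfolding joined_within_def by blast
  have "((\<lambda>t. c (l - t)) has_vector_derivative - c' (l - t)) (at t)" for t
  proof -
    have "(c \<circ> (\<lambda>t. l - t) has_vector_derivative (-1) *\<^sub>R c' (l - t)) (at t)"
      by (rule vector_diff_chain_at) (auto intro!: derivative_eq_intros c)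
    then show ?thesis by (simp add: o_def)
  qed
  moreover have "continuous_on UNIV (\<lambda>t. - c' (l - t))"
    by (intro continuous_intros continuous_on_compose2[OF c(2)]) auto
  ultimately show ?thesis unfolding joined_within_def using c
    by (intro exI[of _ "\<lambda>t. c (l - t)"] exI[of _ "\<lambda>t. - c' (l - t)"]) auto
qed

lemma geo_dist_triangle: "geo_dist \<Omega> x z \<le> geo_dist \<Omega> x y + geo_dist \<Omega> y z"
proof (rule ennreal_le_epsilon)
  fix e :: real assume fin: "geo_dist \<Omega> x y + geo_dist \<Omega> y z < top" and e: "e > 0"
  obtain a b where ab: "geo_dist \<Omega> x y = ennreal a" "geo_dist \<Omega> y z = ennreal b" "a \<ge> 0" "b \<ge> 0"
    using fin by (cases "geo_dist \<Omega> x y"; cases "geo_dist \<Omega> y z") auto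
  have "joined_within (closure \<Omega>) x z ((a + e/2) + (b + e/2))"
    by (rule joined_within_trans[of _ _ y]; (rule joined_within_if_geo_dist_less)?)
       (use ab e in \<open>auto simp: ennreal_less_iff\<close>)
  then have "geo_dist \<Omega> x z \<le> ennreal (a + b + e)"
    using geo_dist_le_if_joined[of \<Omega> x z "a + b + e"] ab e by (simp add: algebra_simps)
  then show "geo_dist \<Omega> x z \<le> geo_dist \<Omega> x y + geo_dist \<Omega> y z + ennreal e"
    using ab e by (simp add: ennreal_plus)
qed

lemma geo_dist_commute: "geo_dist \<Omega> x y = geo_dist \<Omega> y x"
proof -
  have "geo_dist \<Omega> x y \<le> geo_dist \<Omega> y x" for x y
  proof (rule ennreal_le_epsilon)
    fix e :: real assume fin: "geo_dist \<Omega> y x < top" and e: "e > 0"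
    obtain a where a: "geo_dist \<Omega> y x = ennreal a" "a \<ge> 0"
      using fin by (cases "geo_dist \<Omega> y x") auto
    then have "joined_within (closure \<Omega>) y x (a + e)"
      using e by (intro joined_within_if_geo_dist_less) (auto simp: ennreal_less_iff)
    then have "geo_dist \<Omega> x y \<le> ennreal (a + e)"
      using geo_dist_le_if_joined[OF joined_within_sym, of \<Omega> y x "a + e"] a e by (auto simp del: ennreal_plus)
    then show "geo_dist \<Omega> x y \<le> geo_dist \<Omega> y x + ennreal e" using a e by (simp add: ennreal_plus)
  qed
  then show ?thesis by (simp add: antisym)
qed

lemma geo_dist_self:
  assumes "x \<in> closure \<Omega>" shows "geo_dist \<Omega> x x = 0"
  using geo_dist_le_along_curve[of "\<lambda>_. x" "\<lambda>_. 0" 0 \<Omega> 0 x 0 x 0] assms by simp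

lemma joined_within_imp_norm_le:
  assumes "joined_within X x y l" "0 \<le> l"
  shows "norm (x - y) \<le> l"
proof -
  obtain c c' where c: "\<And>t. (c has_vector_derivative c' t) (at t)" 
    "\<And>t. norm (c' t) \<le> 1" "\<And>t. t \<le> 0 \<Longrightarrow> c t = x" "\<And>t. t \<ge> l \<Longrightarrow> c t = y"
    using assms(1) unfolding joined_within_def by blast
  have "norm (c 0 - c l) \<le> 1 * norm (0 - l)"
  proof (rule differentiable_bound[where f' = "\<lambda>t h. h *\<^sub>R c' t" and S = UNIV])
    show "(c has_derivative (\<lambda>h. h *\<^sub>R c' t)) (at t within UNIV)" for t
      using c(1)[of t] by (simp add: has_vector_derivative_def)
    show "onorm (\<lambda>h. h *\<^sub>R c' t) \<le> 1" for t
    proof (rule onorm_bound)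
      show "norm (h *\<^sub>R c' t) \<le> 1 * norm h" for h
        using mult_left_mono[OF c(2)[of t], of "\<bar>h\<bar>"] by simp
    qed simp
  qed auto
  then show ?thesis using c assms by simp
qed

lemma norm_le_geo_dist: "ennreal (norm (x - y)) \<le> geo_dist \<Omega> x y"
proof (rule ennreal_le_epsilon)
  fix e :: real assume fin: "geo_dist \<Omega> x y < top" and e: "e > 0"
  obtain a where a: "geo_dist \<Omega> x y = ennreal a" "a \<ge> 0"
    using fin by (cases "geo_dist \<Omega> x y") auto
  then have "joined_within (closure \<Omega>) x y (a + e)"
    using e by (intro joined_within_if_geo_dist_less) (auto simp: ennreal_less_iff)
  then have "norm (x - y) \<le> a + e" using a e by (intro joined_within_imp_norm_le) auto
  then show "ennreal (norm (x - y)) \<le> geo_dist \<Omega> x y + ennreal e"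
    using a e by (simp add: ennreal_leI flip: ennreal_plus)
qed

text \<open>
A convergent sequence of points whose successive geodesic distances decay geometrically reaches its
limit by an admissible curve. The piece with index \<open>k\<close> has length \<open>\<rho> / 4 ^ k\<close> and is run through at
speed \<open>2 ^ - k\<close>, so it takes the time \<open>\<rho> / 2 ^ k\<close>: the total time is finite, and the velocity tends
to zero at the limit point. The whole curve is the sum of a series of functions that are constant
outside their time intervals; the derivatives converge uniformly.
\<close>

lemma geo_dist_limit_le:
  fixes w :: "nat \<Rightarrow> 'a::euclidean_space"
  assumes J: "\<And>k. joined_within (closure \<Omega>) (w k) (w (Suc k)) (\<rho> * (1/4) ^ k)"
    and lim: "w \<longlonglongrightarrow> z" and \<rho>: "0 < \<rho>"
  shows "geo_dist \<Omega> (w 0) z \<le> ennreal (4 * \<rho>)"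
proof -
  have "\<exists>c c'. (\<forall>t. (c has_vector_derivative c' t) (at t)) \<and> continuous_on UNIV c' \<and>
        (\<forall>t. norm (c' t) \<le> 1) \<and> (\<forall>t. c t \<in> closure \<Omega>) \<and> (\<forall>t\<le>0. c t = w k) \<and>
        (\<forall>t\<ge>\<rho> * (1/4) ^ k. c t = w (Suc k))" for k
    using J[of k] unfolding joined_within_def .
  then obtain c c' where c: "\<And>k t. (c k has_vector_derivative c' k t) (at t)"
    "\<And>k. continuous_on UNIV (c' k)" "\<And>k t. norm (c' k t) \<le> 1" "\<And>k t. c k t \<in> closure \<Omega>"
    "\<And>k t. t \<le> 0 \<Longrightarrow> c k t = w k" "\<And>k t. t \<ge> \<rho> * (1/4) ^ k \<Longrightarrow> c k t = w (Suc k)"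
    by metis
  define l where "l k = (1/2::real) ^ k" for k :: nat
  define a where "a k = 2 * \<rho> * (1 - (1/2) ^ k)" for k :: nat
  define F where "F k t = c k (l k * (t - a k)) - w k" for k t
  define F' where "F' k t = l k *\<^sub>R c' k (l k * (t - a k))" for k t
  define g' where "g' t = (\<Sum>k. F' k t)" for t
  have l0: "l k > 0" for k by (simp add: l_def)
  have sl: "summable l" unfolding l_def[abs_def] by (rule summable_geometric) simp
  have a0: "0 \<le> a k" "a k \<le> 2 * \<rho>" for k
    using \<rho> power_le_one[of "1/2::real" k] by (auto simp: a_def mult_left_le)
  have aS: "a k \<le> a (Suc k)" "l k * (a (Suc k) - a k) = \<rho> * (1/4) ^ k" for k
    using \<rho> power_mult_distrib[of "1/2::real" "1/2" k]
    by (auto simp: a_def l_def algebra_simps)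
  have dF: "(F k has_vector_derivative F' k t) (at t)" for k t
  proof -
    have "(c k \<circ> (\<lambda>t. l k * (t - a k)) has_vector_derivative F' k t) (at t)"
      unfolding F'_def by (rule vector_diff_chain_at) (auto intro!: derivative_eq_intros c)
    then have "((\<lambda>t. c k (l k * (t - a k)) - w k) has_vector_derivative F' k t - 0) (at t)"
      by (intro has_vector_derivative_diff) (auto simp: o_def)
    then show ?thesis by (simp add: F_def[abs_def])
  qed
  have nF: "norm (F' k t) \<le> l k" for k t
    using mult_left_mono[OF c(3)[of k "l k * (t - a k)"], of "l k"] l0[of k] by (simp add: F'_def)
  have ul: "uniform_limit UNIV (\<lambda>n t. \<Sum>i<n. F' i t) g' sequentially"
    unfolding g'_def[abs_def] by (rule Weierstrass_m_test[OF _ sl]) (rule nF)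
  have "\<exists>g. \<forall>t\<in>UNIV. (\<lambda>n. F n t) sums g t \<and> (g has_derivative (\<lambda>h. h *\<^sub>R g' t)) (at t within UNIV)"
  proof (rule has_derivative_series[where f' = "\<lambda>n t h. h *\<^sub>R F' n t" and x = 0])
    show "(F n has_derivative (\<lambda>h. h *\<^sub>R F' n t)) (at t within UNIV)" for n t
      using dF[of n t] by (simp add: has_vector_derivative_def)
    show "\<forall>\<^sub>F n in sequentially. \<forall>t\<in>UNIV. \<forall>h. norm ((\<Sum>i<n. h *\<^sub>R F' i t) - h *\<^sub>R g' t) \<le> e * norm h"
      if "e > 0" for e
    proof (rule eventually_mono[OF uniform_limitD[OF ul that]], intro ballI allI)
      fix n t and h :: real assume *: "\<forall>t\<in>UNIV. dist (\<Sum>i<n. F' i t) (g' t) < e"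
      have "norm ((\<Sum>i<n. h *\<^sub>R F' i t) - h *\<^sub>R g' t) = norm h * dist (\<Sum>i<n. F' i t) (g' t)"
        by (simp add: dist_norm flip: scaleR_sum_right scaleR_diff_right)
      also have "\<dots> \<le> norm h * e" using * by (intro mult_left_mono) (auto intro: less_imp_le)
      finally show "norm ((\<Sum>i<n. h *\<^sub>R F' i t) - h *\<^sub>R g' t) \<le> e * norm h" by (simp add: mult.commute)
    qed
    have "F n 0 = 0" for n
      using a0(1)[of n] l0[of n] by (simp add: F_def c(5) mult_le_0_iff)
    then show "(\<lambda>n. F n 0) sums 0" by simp
  qed auto
  then obtain g where g: "\<And>t. (\<lambda>n. F n t) sums g t" "\<And>t. (g has_vector_derivative g' t) (at t)"
    unfolding has_vector_derivative_def by auto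
  \<comment> \<open>The partial sums are the finite concatenations; they stay in the closed set, hence so does the
    limit.\<close>
  have part: "w 0 + (\<Sum>i<n. F i t) \<in> closure \<Omega> \<and> (t \<ge> a n \<longrightarrow> w 0 + (\<Sum>i<n. F i t) = w n)" for n t
  proof (induction n)
    case 0 show ?case using c(4,5)[of 0 0] by simp
  next
    case (Suc n)
    show ?case
    proof (cases "t \<ge> a n")
      case True
      have "t \<ge> a (Suc n) \<Longrightarrow> l n * (t - a n) \<ge> \<rho> * (1/4) ^ n"
        using aS(2)[of n] mult_left_mono[of "a (Suc n) - a n" "t - a n" "l n"] l0[of n] by simp
      with True Suc show ?thesis by (auto simp: F_def c(4) c(6) simp flip: add.assoc)
    next
      case False
      then have "F n t = 0" using l0[of n] by (simp add: F_def c(5) mult_le_0_iff)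
      with False Suc aS(1)[of n] show ?thesis by auto
    qed
  qed
  have conv: "(\<lambda>n. w 0 + (\<Sum>i<n. F i t)) \<longlonglongrightarrow> w 0 + g t" for t
    using g(1)[of t] unfolding sums_def by (intro tendsto_intros)
  have ende: "w 0 + g (2 * \<rho>) = z"
  proof -
    have "(\<lambda>n. w 0 + (\<Sum>i<n. F i (2 * \<rho>))) = w" using part a0(2) by auto
    then show ?thesis using conv[of "2 * \<rho>"] lim LIMSEQ_unique by metis
  qed
  have start: "w 0 + g 0 = w 0"
  proof -
    have "F n 0 = 0" for n
      using a0(1)[of n] l0[of n] by (simp add: F_def c(5) mult_le_0_iff)
    then show ?thesis using g(1)[of 0] by (simp add: sums_0 sums_unique2)
  qed
  show ?thesis
  proof (rule geo_dist_le_along_curve[where c = "\<lambda>t. w 0 + g t" and c' = g' and L = 2 and a = 0 and b = "2 * \<rho>"])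
    show "((\<lambda>t. w 0 + g t) has_vector_derivative g' t) (at t)" for t
      using g(2)[of t] by (auto intro!: derivative_eq_intros)
    show "continuous_on UNIV g'"
    proof (rule uniform_limit_theorem[OF _ ul])
      have "continuous_on UNIV (\<lambda>t. F' i t)" for i
        unfolding F'_def by (intro continuous_intros continuous_on_compose2[OF c(2)]) auto
      then show "\<forall>\<^sub>F n in sequentially. continuous_on UNIV (\<lambda>t. \<Sum>i<n. F' i t)"
        by (intro always_eventually allI continuous_on_sum) auto
    qed simp
    show "norm (g' t) \<le> 2" for t
    proof -
      have "norm (g' t) \<le> suminf l" unfolding g'_def by (rule norm_suminf_le[OF nF sl])
      also have "suminf l = 2" unfolding l_def[abs_def] by (subst suminf_geometric) auto
      finally show ?thesis .
    qed
    show "w 0 + g t \<in> closure \<Omega>" for t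
      using closed_sequentially[OF closed_closure _ conv] part by blast
  qed (use start ende \<rho> in auto)
qed

section \<open>The geodesic distance on the closure of the domain\<close>

locale geo_domain =
  fixes \<Omega> :: "'a::euclidean_space set" and \<phi> :: "real \<Rightarrow> real" and r :: real
  assumes open_domain: "open \<Omega>" and bounded_domain: "bounded \<Omega>"
    and connected_domain: "connected \<Omega>" and domain_nonempty: "\<Omega> \<noteq> {}"
    and domain: "domain_assumption \<Omega> \<phi> r"
begin

lemma phi_nonneg: "0 \<le> s \<Longrightarrow> 0 \<le> \<phi> s"
  using domain by (auto simp: domain_assumption_def)

lemma r_pos: "0 < r"
  using domain by (auto simp: domain_assumption_def)

lemma geo_dist_le_phi:
  "x \<in> \<Omega> \<Longrightarrow> y \<in> \<Omega> \<Longrightarrow> norm (x - y) \<le> r \<Longrightarrow>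
    geo_dist \<Omega> x y \<le> ennreal (norm (x - y) + \<phi> (norm (x - y)))"
  using domain by (auto simp: domain_assumption_def)

lemma phi_small:
  assumes "0 < \<kappa>"
  obtains s\<^sub>0 where "0 < s\<^sub>0" "s\<^sub>0 \<le> r" "\<And>s. 0 < s \<Longrightarrow> s \<le> s\<^sub>0 \<Longrightarrow> \<phi> s \<le> \<kappa> * s"
proof -
  have "\<forall>\<^sub>F s in at_right 0. \<phi> s / s < \<kappa>"
    using domain assms by (auto simp: domain_assumption_def order_tendsto_iff)
  then obtain b where b: "b > 0" "\<And>s. 0 < s \<Longrightarrow> s < b \<Longrightarrow> \<phi> s / s < \<kappa>"
    by (auto simp: eventually_at_right_field)
  show thesis
    by (rule that[of "min (b/2) r"]) (use b r_pos in \<open>auto simp: field_simps intro: less_imp_le\<close>)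
qed

text \<open>
Euclidean and geodesic distance are comparable at small scales up to and including the boundary. The
domain assumption gives this inside; the limit curve carries it to boundary points.
\<close>

lemma geo_dist_closure_lipschitz:
  obtains \<rho> where "0 < \<rho>" 
    "\<And>x y. x \<in> closure \<Omega> \<Longrightarrow> y \<in> closure \<Omega> \<Longrightarrow> norm (x - y) < \<rho> \<Longrightarrow>
       geo_dist \<Omega> x y \<le> ennreal (96 * norm (x - y))"
proof -
  obtain s\<^sub>0 where s0: "0 < s\<^sub>0" "s\<^sub>0 \<le> r" "\<And>s. 0 < s \<Longrightarrow> s \<le> s\<^sub>0 \<Longrightarrow> \<phi> s \<le> 1 * s"
    using phi_small[of 1] by auto
  have close: "geo_dist \<Omega> x y \<le> ennreal (2 * norm (x - y))" if "x \<in> \<Omega>" "y \<in> \<Omega>" "norm (x - y) \<le> s\<^sub>0" for x y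
  proof (cases "x = y")
    case True
    then show ?thesis using geo_dist_self[of x \<Omega>] that closure_subset[of \<Omega>] by auto
  next
    case False
    have "geo_dist \<Omega> x y \<le> ennreal (norm (x - y) + \<phi> (norm (x - y)))"
      using geo_dist_le_phi that s0 by auto
    also have "\<dots> \<le> ennreal (2 * norm (x - y))"
      using s0(3)[of "norm (x - y)"] False that by (intro ennreal_leI) auto
    finally show ?thesis .
  qed
  have half: "geo_dist \<Omega> w z \<le> ennreal (32 * norm (w - z))"
    if w: "w \<in> \<Omega>" and z: "z \<in> closure \<Omega>" and wz: "norm (w - z) < s\<^sub>0 / 2" for w z
  proof (cases "w = z")
    case True
    then show ?thesis using geo_dist_self z by simp
  next
    case False
    define R where "R = norm (w - z)"
    have R: "R > 0" "2 * R \<le> s\<^sub>0" using False wz by (auto simp: R_def)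
    have "\<exists>v\<in>\<Omega>. norm (v - z) \<le> R * (1/4) ^ k" for k :: nat
    proof -
      have "R * (1/4) ^ k > 0" using R by simp
      then obtain v where "v \<in> \<Omega>" "dist v z < R * (1/4) ^ k"
        using z closure_approachable by metis
      then show ?thesis by (intro bexI[of _ v]) (auto simp: dist_norm)
    qed
    then obtain v where v: "\<And>k. v k \<in> \<Omega>" "\<And>k. norm (v k - z) \<le> R * (1/4) ^ k" by metis
    define u where "u k = (if k = 0 then w else v k)" for k :: nat
    have u: "u k \<in> \<Omega>" "norm (u k - z) \<le> R * (1/4) ^ k" for k
      using v w by (auto simp: u_def R_def)
    have q: "R * (1/4) ^ Suc k \<le> R * (1/4) ^ k" "R * (1/4) ^ k \<le> R" for k :: nat
      using R power_le_one[of "1/4::real" k] by (auto simp: mult_left_le)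
    have step: "norm (u k - u (Suc k)) \<le> 2 * (R * (1/4) ^ k)" for k
      using norm_triangle_ineq4[of "u k - z" "u (Suc k) - z"] u(2)[of k] u(2)[of "Suc k"] q(1)[of k]
      by simp
    have "geo_dist \<Omega> (u 0) z \<le> ennreal (4 * (8 * R))"
    proof (rule geo_dist_limit_le)
      fix k
      have "geo_dist \<Omega> (u k) (u (Suc k)) \<le> ennreal (2 * norm (u k - u (Suc k)))"
        using step[of k] q(2)[of k] R by (intro close u) linarith
      also have "\<dots> < ennreal (8 * R * (1/4) ^ k)"
        using step[of k] mult_pos_pos[OF R(1), of "(1/4) ^ k"]
        by (subst ennreal_less_iff) (auto simp: mult.assoc)
      finally show "joined_within (closure \<Omega>) (u k) (u (Suc k)) (8 * R * (1/4) ^ k)"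
        by (rule joined_within_if_geo_dist_less)
    next
      have "(\<lambda>k. R * (1/4::real) ^ k) \<longlonglongrightarrow> 0"
        by (rule tendsto_mult_right_zero) (rule LIMSEQ_realpow_zero; simp)
      moreover have "\<forall>\<^sub>F k in sequentially. norm (u k - z) \<le> R * (1/4) ^ k"
        by (intro always_eventually allI u(2))
      ultimately have "(\<lambda>k. u k - z) \<longlonglongrightarrow> 0"
        by (rule Lim_null_comparison[rotated])
      then show "u \<longlonglongrightarrow> z" by (simp add: LIM_zero_iff)
    qed (use R in simp)
    then show ?thesis by (simp add: u_def R_def)
  qed
  show thesis
  proof (rule that[of "s\<^sub>0 / 4"])
    fix x y assume xy: "x \<in> closure \<Omega>" "y \<in> closure \<Omega>" "norm (x - y) < s\<^sub>0 / 4"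
    show "geo_dist \<Omega> x y \<le> ennreal (96 * norm (x - y))"
    proof (cases "x = y")
      case True
      then show ?thesis using geo_dist_self xy by simp
    next
      case False
      then obtain w where w: "w \<in> \<Omega>" "dist w y < norm (x - y)"
        using xy closure_approachable[of y \<Omega>] by (metis zero_less_norm_iff right_minus_eq)
      have n: "norm (w - y) \<le> norm (x - y)" "norm (w - x) \<le> 2 * norm (x - y)"
        using w norm_triangle_ineq[of "w - y" "y - x"] by (auto simp: dist_norm norm_minus_commute)
      have "geo_dist \<Omega> x y \<le> geo_dist \<Omega> w x + geo_dist \<Omega> w y"
        using geo_dist_triangle[of \<Omega> x y w] geo_dist_commute[of \<Omega> x w] by simp
      also have "\<dots> \<le> ennreal (32 * norm (w - x)) + ennreal (32 * norm (w - y))"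
        using n xy w s0(1) by (intro add_mono half) auto
      also have "\<dots> = ennreal (32 * norm (w - x) + 32 * norm (w - y))"
        by (simp add: ennreal_plus)
      also have "\<dots> \<le> ennreal (96 * norm (x - y))"
        using n by (intro ennreal_leI) linarith
      finally show ?thesis .
    qed
  qed (use s0 in auto)
qed

text \<open>
Finiteness of the distance to a fixed point is locally constant, and the closure is connected.
\<close>

lemma geo_dist_finite:
  assumes "x \<in> closure \<Omega>" "y \<in> closure \<Omega>"
  shows "geo_dist \<Omega> x y < top"
proof -
  obtain \<rho> where \<rho>: "0 < \<rho>" 
    "\<And>x y. x \<in> closure \<Omega> \<Longrightarrow> y \<in> closure \<Omega> \<Longrightarrow> norm (x - y) < \<rho> \<Longrightarrow>
       geo_dist \<Omega> x y \<le> ennreal (96 * norm (x - y))"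
    using geo_dist_closure_lipschitz by metis
  have "(geo_dist \<Omega> x x = top) = (geo_dist \<Omega> x y = top)"
  proof (rule connected_local_const[OF connected_imp_connected_closure[OF connected_domain] assms], intro ballI)
    fix a assume a: "a \<in> closure \<Omega>"
    show "\<forall>\<^sub>F b in at a within closure \<Omega>. (geo_dist \<Omega> x a = top) = (geo_dist \<Omega> x b = top)"
      unfolding eventually_at
    proof (intro exI[of _ \<rho>] conjI ballI impI)
      fix b assume b: "b \<in> closure \<Omega>" "b \<noteq> a \<and> dist b a < \<rho>"
      then have "geo_dist \<Omega> a b \<le> ennreal (96 * norm (a - b))"
        using a by (intro \<rho>) (auto simp: dist_norm norm_minus_commute)
      then have fin: "geo_dist \<Omega> a b < top" using ennreal_less_top le_less_trans by blast
      have "geo_dist \<Omega> x a < top \<longleftrightarrow> geo_dist \<Omega> x b < top"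
      proof
        assume "geo_dist \<Omega> x a < top"
        then have "geo_dist \<Omega> x a + geo_dist \<Omega> a b < top" using fin by simp
        then show "geo_dist \<Omega> x b < top" using geo_dist_triangle le_less_trans by blast
      next
        assume "geo_dist \<Omega> x b < top"
        then have "geo_dist \<Omega> x b + geo_dist \<Omega> b a < top"
          using fin geo_dist_commute[of \<Omega> a b] by simp
        then show "geo_dist \<Omega> x a < top" using geo_dist_triangle le_less_trans by blast
      qed
      then show "(geo_dist \<Omega> x a = top) = (geo_dist \<Omega> x b = top)"
        by (simp add: less_top[symmetric])
    qed (rule \<rho>(1))
  qed
  then show ?thesis using geo_dist_self[OF assms(1)] by (simp add: less_top)
qed

definition rdist :: "'a \<Rightarrow> 'a \<Rightarrow> real" where
  "rdist x y = enn2real (geo_dist \<Omega> x y)"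

lemma ennreal_rdist: "x \<in> closure \<Omega> \<Longrightarrow> y \<in> closure \<Omega> \<Longrightarrow> ennreal (rdist x y) = geo_dist \<Omega> x y"
  unfolding rdist_def using geo_dist_finite by simp

lemma rdist_nonneg [simp]: "0 \<le> rdist x y" by (simp add: rdist_def)

lemma rdist_commute: "rdist x y = rdist y x" by (simp add: rdist_def geo_dist_commute)

lemma rdist_self: "x \<in> closure \<Omega> \<Longrightarrow> rdist x x = 0" by (simp add: rdist_def geo_dist_self)

lemma rdist_le_iff:
  assumes "x \<in> closure \<Omega>" "y \<in> closure \<Omega>" "0 \<le> l"
  shows "rdist x y \<le> l \<longleftrightarrow> geo_dist \<Omega> x y \<le> ennreal l"
  using ennreal_rdist[OF assms(1,2)] assms(3) by (metis ennreal_le_iff)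

lemma rdist_less_iff:
  assumes "x \<in> closure \<Omega>" "y \<in> closure \<Omega>"
  shows "rdist x y < l \<longleftrightarrow> geo_dist \<Omega> x y < ennreal l"
  using ennreal_rdist[OF assms(1,2)] by (metis rdist_nonneg ennreal_less_iff)

lemma rdist_triangle:
  assumes "x \<in> closure \<Omega>" "y \<in> closure \<Omega>" "z \<in> closure \<Omega>"
  shows "rdist x z \<le> rdist x y + rdist y z"
  using geo_dist_triangle[of \<Omega> x z y] assms
  by (subst rdist_le_iff) (simp_all add: ennreal_plus ennreal_rdist)

lemma norm_le_rdist:
  assumes "x \<in> closure \<Omega>" "y \<in> closure \<Omega>"
  shows "norm (x - y) \<le> rdist x y"
  using norm_le_geo_dist[of x y \<Omega>] ennreal_rdist[OF assms] by (metis rdist_nonneg ennreal_le_iff)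

lemma rdist_le_phi: 
  assumes "x \<in> \<Omega>" "y \<in> \<Omega>" "norm (x - y) \<le> r"
  shows "rdist x y \<le> norm (x - y) + \<phi> (norm (x - y))"
  using geo_dist_le_phi[OF assms] assms closure_subset[of \<Omega>] phi_nonneg[of "norm (x - y)"]
  by (subst rdist_le_iff) auto

lemma rdist_closure_lipschitz:
  obtains \<rho> where "0 < \<rho>" 
    "\<And>x y. x \<in> closure \<Omega> \<Longrightarrow> y \<in> closure \<Omega> \<Longrightarrow> norm (x - y) < \<rho> \<Longrightarrow> rdist x y \<le> 96 * norm (x - y)"
  using geo_dist_closure_lipschitz by (metis rdist_le_iff mult_nonneg_nonneg norm_ge_zero zero_le_numeral)

lemma rdist_small_ball:
  assumes "0 < e"
  obtains \<rho> where "0 < \<rho>" 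
    "\<And>x y. x \<in> closure \<Omega> \<Longrightarrow> y \<in> closure \<Omega> \<Longrightarrow> norm (x - y) < \<rho> \<Longrightarrow> rdist x y < e"
proof -
  obtain \<rho> where \<rho>: "0 < \<rho>" 
    "\<And>x y. x \<in> closure \<Omega> \<Longrightarrow> y \<in> closure \<Omega> \<Longrightarrow> norm (x - y) < \<rho> \<Longrightarrow> rdist x y \<le> 96 * norm (x - y)"
    using rdist_closure_lipschitz by metis
  show thesis
  proof (rule that[of "min \<rho> (e / 97)"])
    fix x y assume "x \<in> closure \<Omega>" "y \<in> closure \<Omega>" "norm (x - y) < min \<rho> (e / 97)"
    then show "rdist x y < e" using \<rho>(2)[of x y] assms by simp
  qed (use \<rho> assms in auto)
qed

lemma domain_approachable:
  assumes "z \<in> closure \<Omega>" "0 < e"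
  obtains w where "w \<in> \<Omega>" "w \<in> closure \<Omega>" "norm (w - z) < e" "rdist w z < e"
proof -
  obtain \<rho> where \<rho>: "0 < \<rho>" 
    "\<And>x y. x \<in> closure \<Omega> \<Longrightarrow> y \<in> closure \<Omega> \<Longrightarrow> norm (x - y) < \<rho> \<Longrightarrow> rdist x y < e"
    using rdist_small_ball[OF assms(2)] by metis
  obtain w where "w \<in> \<Omega>" "dist w z < min \<rho> e"
    using assms \<rho>(1) closure_approachable[of z \<Omega>] by (metis min_less_iff_conj)
  then show thesis using that \<rho>(2)[of w z] assms closure_subset[of \<Omega>] by (auto simp: dist_norm)
qed

lemma rdist_bounded: obtains B where "0 < B" "\<And>x y. x \<in> closure \<Omega> \<Longrightarrow> y \<in> closure \<Omega> \<Longrightarrow> rdist x y \<le> B"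
proof -
  obtain p where p: "p \<in> \<Omega>" using domain_nonempty by auto
  then have pc: "p \<in> closure \<Omega>" using closure_subset by auto
  have "continuous_on (closure \<Omega>) (rdist p)"
    unfolding continuous_on_iff
  proof (intro ballI allI impI)
    fix x and e :: real assume x: "x \<in> closure \<Omega>" and e: "e > 0"
    obtain \<rho> where \<rho>: "0 < \<rho>" 
      "\<And>x y. x \<in> closure \<Omega> \<Longrightarrow> y \<in> closure \<Omega> \<Longrightarrow> norm (x - y) < \<rho> \<Longrightarrow> rdist x y < e"
      using rdist_small_ball[OF e] by metis
    show "\<exists>d>0. \<forall>x'\<in>closure \<Omega>. dist x' x < d \<longrightarrow> dist (rdist p x') (rdist p x) < e"
    proof (intro exI[of _ \<rho>] conjI ballI impI)
      fix x' assume x': "x' \<in> closure \<Omega>" "dist x' x < \<rho>"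
      then have "rdist x x' < e" using \<rho>(2)[of x x'] x by (simp add: dist_norm norm_minus_commute)
      then show "dist (rdist p x') (rdist p x) < e"
        using rdist_triangle[OF pc x x'(1)] rdist_triangle[OF pc x'(1) x] rdist_commute[of x x']
        by (simp add: dist_real_def)
    qed (rule \<rho>)
  qed
  moreover have "compact (closure \<Omega>)" using bounded_domain by simp
  ultimately have "bounded (rdist p ` closure \<Omega>)"
    using compact_continuous_image compact_imp_bounded by blast
  then obtain b where b: "\<And>x. x \<in> closure \<Omega> \<Longrightarrow> rdist p x \<le> b"
    unfolding bounded_iff by force
  show thesis
  proof (rule that[of "2 * \<bar>b\<bar> + 1"])
    fix x y assume xy: "x \<in> closure \<Omega>" "y \<in> closure \<Omega>"
    show "rdist x y \<le> 2 * \<bar>b\<bar> + 1"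
      using rdist_triangle[OF xy(1) pc xy(2)] b[OF xy(1)] b[OF xy(2)] rdist_commute[of x p] by linarith
  qed auto
qed

lemma rdist_path:
  assumes "x \<in> closure \<Omega>" "y \<in> closure \<Omega>" "rdist x y < l"
  obtains c where "continuous_on UNIV c" "\<And>t. c t \<in> closure \<Omega>" "c 0 = x" "c l = y"
    "\<And>t. 0 \<le> t \<Longrightarrow> t \<le> l \<Longrightarrow> rdist x (c t) \<le> t" "\<And>t. 0 \<le> t \<Longrightarrow> t \<le> l \<Longrightarrow> rdist (c t) y \<le> l - t"
proof -
  obtain c c' where c: "\<And>t. (c has_vector_derivative c' t) (at t)" "continuous_on UNIV c'"
    "\<And>t. norm (c' t) \<le> 1" "\<And>t. c t \<in> closure \<Omega>" "\<And>t. t \<le> 0 \<Longrightarrow> c t = x" "\<And>t. t \<ge> l \<Longrightarrow> c t = y"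
    using joined_within_if_geo_dist_less[of \<Omega> x y l] assms rdist_less_iff[OF assms(1,2)] 
    unfolding joined_within_def by blast
  show thesis
  proof (rule that[of c])
    show "continuous_on UNIV c"
      using c(1) has_vector_derivative_continuous continuous_at_imp_continuous_on by blast
    show "rdist x (c t) \<le> t" if "0 \<le> t" "t \<le> l" for t
      using geo_dist_le_along_curve[OF c(1-4), of 0 x t "c t" t] c that assms
      by (subst rdist_le_iff) auto
    show "rdist (c t) y \<le> l - t" if "0 \<le> t" "t \<le> l" for t
      using geo_dist_le_along_curve[OF c(1-4), of t "c t" l y "l - t"] c that assms
      by (subst rdist_le_iff) auto
  qed (use c in auto)
qed

text \<open>
A nearly shortest curve from \<open>x\<close> to \<open>y\<close> that starts inside a ball and ends outside meets its sphere
in a point through which the triangle inequality is almost an equality.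
\<close>

lemma rdist_sphere_point:
  assumes x: "x \<in> closure \<Omega>" and y: "y \<in> closure \<Omega>" and e: "0 < e"
    and s: "norm (q - x) \<le> s" "s \<le> norm (q - y)"
  obtains p where "p \<in> closure \<Omega>" "norm (q - p) = s" "rdist x p + rdist p y < rdist x y + e"
proof -
  define l where "l = rdist x y + e / 2"
  have l: "rdist x y < l" "0 \<le> l" using e rdist_nonneg[of x y] by (auto simp: l_def simp del: rdist_nonneg)
  obtain c where c: "continuous_on UNIV c" "\<And>t. c t \<in> closure \<Omega>" "c 0 = x" "c l = y"
    "\<And>t. 0 \<le> t \<Longrightarrow> t \<le> l \<Longrightarrow> rdist x (c t) \<le> t" "\<And>t. 0 \<le> t \<Longrightarrow> t \<le> l \<Longrightarrow> rdist (c t) y \<le> l - t"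
    using rdist_path[OF x y l(1)] by metis
  have "continuous_on {0..l} (\<lambda>t. norm (q - c t))"
    by (intro continuous_intros continuous_on_subset[OF c(1)]) auto
  then obtain t where t: "0 \<le> t" "t \<le> l" "norm (q - c t) = s"
    using IVT'[of "\<lambda>t. norm (q - c t)" 0 s l] s l c by auto
  show thesis
    by (rule that[of "c t"]) (use t c(2) c(5,6)[OF t(1,2)] e in \<open>auto simp: l_def\<close>)
qed

end

section \<open>Length of chains of jumps\<close>

text \<open>
If going along \<open>u\<close> and then \<open>v\<close> is nearly straight, then the component of \<open>u\<close> in the
direction of \<open>v\<close> is at least \<^term>\<open>norm u - 2 * p\<close>: factor the difference of the squares of the two
sides of the triangle inequality.
\<close>

lemma collinearity_defect:
  fixes u v :: "'a::real_inner"
  assumes "norm u + norm v \<le> norm (u + v) + p" "norm u \<le> norm v"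
  shows "norm u * norm v - u \<bullet> v \<le> 2 * p * norm v"
proof -
  define S N where "S = norm u + norm v" and "N = norm (u + v)"
  have SN: "N \<le> S" "S - N \<le> p" "S + N \<le> 4 * norm v" "0 \<le> S + N"
    using assms norm_triangle_ineq[of u v] by (auto simp: S_def N_def)
  have "2 * (norm u * norm v - u \<bullet> v) = S\<^sup>2 - N\<^sup>2"
    using dot_norm[of u v] by (simp add: S_def N_def power2_sum)
  also have "\<dots> = (S - N) * (S + N)" by (simp add: power2_eq_square algebra_simps)
  also have "\<dots> \<le> p * (4 * norm v)" using SN by (intro mult_mono) auto
  finally show ?thesis by simp
qed

text \<open>
If the paths \<open>u, v\<close> and \<open>v, w\<close> are straight up to \<open>p\<close> and overlap in the longest vector \<open>v\<close>, then the
whole path is straight up to a multiple of \<open>p\<close>: project everything to the direction of \<open>v\<close>.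
\<close>

lemma nearly_straight_join:
  fixes u v w :: "'a::real_inner"
  assumes uv: "norm u + norm v \<le> norm (u + v) + p" and vw: "norm v + norm w \<le> norm (v + w) + p"
    and le: "norm u \<le> norm v" "norm w \<le> norm v" and v: "v \<noteq> 0"
  shows "norm u + norm v + norm w \<le> norm (u + v + w) + 4 * p"
proof -
  have "norm u * norm v - u \<bullet> v \<le> 2 * p * norm v" by (rule collinearity_defect[OF uv le(1)])
  moreover have "norm w * norm v - w \<bullet> v \<le> 2 * p * norm v"
    by (rule collinearity_defect) (use vw le in \<open>simp_all add: add.commute\<close>)
  moreover have "(u + v + w) \<bullet> v \<le> norm (u + v + w) * norm v" by (rule norm_cauchy_schwarz)
  moreover have "v \<bullet> v = norm v * norm v" by (simp add: power2_norm_eq_inner flip: power2_eq_square)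
  ultimately have "(norm u + norm v + norm w) * norm v \<le> (norm (u + v + w) + 4 * p) * norm v"
    by (simp add: inner_add_left algebra_simps)
  then show ?thesis using v by simp
qed

context geo_domain
begin

text \<open>
The key step: a jump on the way to \<open>y\<close> loses only \<open>\<phi> h\<close>, whatever its length. A nearly shortest
curve from \<open>z'\<close> to \<open>y\<close> leaves the ball of radius \<open>h\<close> about \<open>z\<close> at a point \<open>p\<close>, and \<open>z\<close> is joined to \<open>p\<close> directly.
The domain assumption needs two points of the open set at distance exactly \<open>h\<close>, because \<open>\<phi>\<close> need
not be continuous. Take \<open>w\<close> in the domain close to \<open>p\<close> and correct the distance by moving \<open>z\<close>,
which has a whole ball around it in the domain.
\<close>

lemma rdist_jump_from_interior:
  assumes z: "z \<in> \<Omega>" and z': "z' \<in> closure \<Omega>" and y: "y \<in> closure \<Omega>"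
    and near: "norm (z - z') \<le> h" and far: "h \<le> norm (z - y)" and h: "0 < h" "h \<le> r"
  shows "rdist z y \<le> norm (z - z') + \<phi> h + rdist z' y"
proof (rule field_le_epsilon)
  fix e :: real assume e: "e > 0"
  have zc: "z \<in> closure \<Omega>" using z closure_subset by auto
  obtain p where p: "p \<in> closure \<Omega>" "norm (z - p) = h" "rdist z' p + rdist p y < rdist z' y + e/4"
    using rdist_sphere_point[OF z' y _ near far] e by (metis zero_less_divide_iff zero_less_numeral)
  obtain \<kappa> where \<kappa>: "0 < \<kappa>" "ball z \<kappa> \<subseteq> \<Omega>" using open_domain z open_contains_ball by metis
  obtain \<rho> where \<rho>: "0 < \<rho>" 
    "\<And>x y. x \<in> closure \<Omega> \<Longrightarrow> y \<in> closure \<Omega> \<Longrightarrow> norm (x - y) < \<rho> \<Longrightarrow> rdist x y < e/4"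
    using rdist_small_ball[of "e/4"] e by auto
  have "0 < Min {\<kappa>, \<rho>, e/4, h}" using \<kappa> \<rho> e h by simp
  then obtain w where w: "w \<in> \<Omega>" "w \<in> closure \<Omega>" "norm (w - p) < Min {\<kappa>, \<rho>, e/4, h}"
      "rdist w p < Min {\<kappa>, \<rho>, e/4, h}"
    using domain_approachable[OF p(1)] by metis
  define n where "n = norm (z - w)"
  have n: "\<bar>n - h\<bar> \<le> norm (w - p)"
    using norm_triangle_ineq3[of "z - w" "z - p"] p(2) by (simp add: n_def norm_minus_commute)
  have "norm (w - p) < h" using w(3) by simp
  then have n0: "n > 0" using n by linarith
  define z2 where "z2 = w + (h / n) *\<^sub>R (z - w)"
  have z2w: "norm (z2 - w) = h" using n0 h by (simp add: z2_def n_def)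
  have "z2 - z = (h / n - 1) *\<^sub>R (z - w)" by (simp add: z2_def algebra_simps)
  then have "norm (z2 - z) = \<bar>h / n - 1\<bar> * n" by (simp add: n_def)
  also have "\<dots> = \<bar>h - n\<bar>" using n0 by (simp add: abs_if field_simps)
  finally have z2z: "norm (z2 - z) \<le> norm (w - p)" using n by simp
  have z2: "z2 \<in> \<Omega>" using \<kappa>(2) z2z w(3) by (auto simp: dist_norm norm_minus_commute subset_iff)
  then have z2c: "z2 \<in> closure \<Omega>" using closure_subset by auto
  have 1: "rdist z z2 < e/4" using z2z w(3) by (intro \<rho> zc z2c) (simp add: norm_minus_commute)
  have 2: "rdist z2 w \<le> h + \<phi> h" using rdist_le_phi[OF z2 w(1)] z2w h by simp
  have w4: "rdist w p < e/4" using w(4) by simp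
  have 3: "h \<le> norm (z - z') + rdist z' p"
    using norm_triangle_ineq[of "z - z'" "z' - p"] norm_le_rdist[OF z' p(1)] p(2) by simp
  have "rdist z y \<le> rdist z z2 + rdist z2 w + rdist w p + rdist p y"
    using rdist_triangle[OF zc z2c y] rdist_triangle[OF z2c w(2) y] rdist_triangle[OF w(2) p(1) y] by simp
  then show "rdist z y \<le> norm (z - z') + \<phi> h + rdist z' y + e"
    using 1 2 3 w4 p(3) e by linarith
qed

text \<open>
The same for points of the closure: \<open>z\<close> is approximated from inside, which keeps
the first distance below \<open>h\<close>. The bound on the second distance is a hypothesis on the approximating
points, since it will be applied with \<open>y\<close> at distance exactly \<open>h\<close>.
\<close>

lemma rdist_jump_strict:
  assumes z: "z \<in> closure \<Omega>" and z': "z' \<in> closure \<Omega>" and y: "y \<in> closure \<Omega>"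
    and near: "norm (z - z') < h" and h: "0 < h" "h \<le> r"
    and far: "0 < \<rho>" "\<And>w. w \<in> \<Omega> \<Longrightarrow> norm (w - z) < \<rho> \<Longrightarrow> h \<le> norm (w - y)"
  shows "rdist z y \<le> norm (z - z') + \<phi> h + rdist z' y"
proof (rule field_le_epsilon)
  fix e :: real assume e: "e > 0"
  have "0 < Min {\<rho>, e/2, h - norm (z - z')}" using e near far by simp
  then obtain w where w: "w \<in> \<Omega>" "w \<in> closure \<Omega>" "norm (w - z) < Min {\<rho>, e/2, h - norm (z - z')}"
      "rdist w z < Min {\<rho>, e/2, h - norm (z - z')}"
    using domain_approachable[OF z] by metis
  have n: "norm (w - z') \<le> norm (w - z) + norm (z - z')"
    using norm_triangle_ineq[of "w - z" "z - z'"] by simp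
  then have "rdist w y \<le> norm (w - z') + \<phi> h + rdist z' y"
    using w by (intro rdist_jump_from_interior z' y h far) auto
  then show "rdist z y \<le> norm (z - z') + \<phi> h + rdist z' y + e"
    using rdist_triangle[OF z w(2) y] n w(3,4) by (simp add: rdist_commute)
qed

lemma rdist_near:
  assumes x: "x \<in> closure \<Omega>" and y: "y \<in> closure \<Omega>" and xy: "norm (x - y) < h"
    and h: "h \<le> r" and \<phi>: "\<And>s. 0 < s \<Longrightarrow> s \<le> h \<Longrightarrow> \<phi> s \<le> s / 4"
  shows "rdist x y \<le> 5/4 * norm (x - y)"
proof (rule field_le_epsilon)
  fix e :: real assume e: "e > 0"
  define d where "d = min (e/6) ((h - norm (x - y)) / 2)"
  have d: "0 < d" "6 * d \<le> e" "norm (x - y) + 2 * d \<le> h" 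
  proof -
    show "0 < d" using e xy by (simp add: d_def)
    have "d \<le> e/6" "d \<le> (h - norm (x - y)) / 2"
      unfolding d_def by (rule min.cobounded1, rule min.cobounded2)
    then show "6 * d \<le> e" "norm (x - y) + 2 * d \<le> h" by (simp_all add: field_simps)
  qed
  obtain v where v: "v \<in> \<Omega>" "v \<in> closure \<Omega>" "norm (v - x) < d" "rdist v x < d"
    using domain_approachable[OF x d(1)] by metis
  obtain w where w: "w \<in> \<Omega>" "w \<in> closure \<Omega>" "norm (w - y) < d" "rdist w y < d"
    using domain_approachable[OF y d(1)] by metis
  have n: "norm (v - w) \<le> norm (x - y) + 2 * d"
    using norm_triangle_ineq[of "v - x" "x - w"] norm_triangle_ineq[of "x - y" "y - w"] v(3) w(3)
    by (simp add: norm_minus_commute)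
  have "rdist v w \<le> 5/4 * norm (v - w)"
  proof (cases "v = w")
    case False
    then show ?thesis
      using rdist_le_phi[OF v(1) w(1)] \<phi>[of "norm (v - w)"] n d(3) h by simp
  qed (use v rdist_self in simp)
  then show "rdist x y \<le> 5/4 * norm (x - y) + e"
    using rdist_triangle[OF x v(2) y] rdist_triangle[OF v(2) w(2) y] v(4) w(4) n d
    by (simp add: rdist_commute)
qed

text \<open>
The jump estimate for all points of the closure. Only \<^term>\<open>norm (z - z') = h\<close> is new. If interior
pairs at distance at most \<open>h\<close> come arbitrarily close to the pair, one passes to the limit. Otherwise
a wall of thickness \<open>h\<close> separates \<open>z\<close> from \<open>z'\<close>. Then every point of the domain near \<open>z\<close> is at least \<open>h\<close> away from \<open>z'\<close> and
conversely, so that the strict version applies with \<open>z'\<close> itself as the target, in both directions.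
It shows that a nearly shortest curve from \<open>z\<close> to \<open>z'\<close> is almost straight from \<open>z\<close> to any intermediate
point within \<open>h\<close> of \<open>z\<close>, and from any intermediate point within \<open>h\<close> of \<open>z'\<close> to \<open>z'\<close>. Two points at distance \<open>h / 3\<close> from the ends give two overlapping almost
straight pieces, so the whole curve is almost straight.
\<close>

lemma rdist_jump:
  assumes z: "z \<in> closure \<Omega>" and z': "z' \<in> closure \<Omega>" and y: "y \<in> closure \<Omega>"
    and near: "norm (z - z') \<le> h" and far: "h < norm (z - y)"
    and h: "0 < h" "h < h\<^sub>0" "h\<^sub>0 \<le> r" and \<phi>: "\<And>s. 0 < s \<Longrightarrow> s \<le> h\<^sub>0 \<Longrightarrow> \<phi> s \<le> s / 4"
  shows "rdist z y \<le> norm (z - z') + 6 * \<phi> h + rdist z' y"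
proof -
  have \<phi>0: "0 \<le> \<phi> h" using phi_nonneg h by simp
  have far_near: "h \<le> norm (w - y)" if "norm (w - z) < norm (z - y) - h" for w
    using norm_triangle_ineq[of "z - w" "w - y"] that by (simp add: norm_minus_commute)
  consider (less) "norm (z - z') < h"
    | (approx) "norm (z - z') = h" 
        "\<And>\<rho>. 0 < \<rho> \<Longrightarrow> \<exists>v\<in>\<Omega>. \<exists>w\<in>\<Omega>. norm (v - z) < \<rho> \<and> norm (w - z') < \<rho> \<and> norm (v - w) \<le> h"
    | (wall) \<rho> where "norm (z - z') = h" "0 < \<rho>" 
        "\<And>v w. v \<in> \<Omega> \<Longrightarrow> w \<in> \<Omega> \<Longrightarrow> norm (v - z) < \<rho> \<Longrightarrow> norm (w - z') < \<rho> \<Longrightarrow> h < norm (v - w)"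
    using near by (meson not_le order_le_less)
  then show ?thesis
  proof cases
    case less
    have "rdist z y \<le> norm (z - z') + \<phi> h + rdist z' y"
      by (rule rdist_jump_strict[OF z z' y less, where \<rho> = "norm (z - y) - h"]) (use h far far_near in auto)
    then show ?thesis using \<phi>0 by simp
  next
    case approx
    have "rdist z y \<le> h + \<phi> h + rdist z' y"
    proof (rule field_le_epsilon)
      fix e :: real assume e: "e > 0"
      obtain \<rho> where \<rho>: "0 < \<rho>" 
        "\<And>x y. x \<in> closure \<Omega> \<Longrightarrow> y \<in> closure \<Omega> \<Longrightarrow> norm (x - y) < \<rho> \<Longrightarrow> rdist x y < e/2"
        using rdist_small_ball[of "e/2"] e by auto
      have "0 < min \<rho> (norm (z - y) - h)" using \<rho> far by simp
      then obtain v w where vw: "v \<in> \<Omega>" "w \<in> \<Omega>" "norm (v - z) < min \<rho> (norm (z - y) - h)"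
          "norm (w - z') < min \<rho> (norm (z - y) - h)" "norm (v - w) \<le> h"
        using approx(2) by metis
      have c: "v \<in> closure \<Omega>" "w \<in> closure \<Omega>" using vw closure_subset by auto
      have "rdist v y \<le> norm (v - w) + \<phi> h + rdist w y"
        using h vw by (intro rdist_jump_from_interior c y far_near) auto
      moreover have "rdist z v < e/2" "rdist w z' < e/2"
        using \<rho>(2)[OF z c(1)] \<rho>(2)[OF c(2) z'] vw(3,4) by (simp_all add: norm_minus_commute)
      ultimately show "rdist z y \<le> h + \<phi> h + rdist z' y + e"
        using rdist_triangle[OF z c(1) y] rdist_triangle[OF c(2) z' y] vw(5) by simp
    qed
    then show ?thesis using \<phi>0 approx(1) by simp
  next
    case wall
    have far1: "h \<le> norm (v - z')" if "v \<in> \<Omega>" "norm (v - z) < \<rho>" for v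
    proof (rule field_le_epsilon)
      fix e :: real assume "e > 0"
      then obtain w where w: "w \<in> \<Omega>" "norm (w - z') < min \<rho> e"
        using domain_approachable[OF z', of "min \<rho> e"] wall(2) by auto
      then show "h \<le> norm (v - z') + e"
        using wall(3)[OF that(1) w(1) that(2)] norm_triangle_ineq4[of "v - z'" "w - z'"] by simp
    qed
    have far2: "h \<le> norm (w - z)" if "w \<in> \<Omega>" "norm (w - z') < \<rho>" for w
    proof (rule field_le_epsilon)
      fix e :: real assume "e > 0"
      then obtain v where v: "v \<in> \<Omega>" "norm (v - z) < min \<rho> e"
        using domain_approachable[OF z, of "min \<rho> e"] wall(2) by auto
      then show "h \<le> norm (w - z) + e"
        using wall(3)[OF v(1) that(1) _ that(2)] norm_triangle_ineq4[of "v - z" "w - z"]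
        by (simp add: norm_minus_commute)
    qed
    have via1: "rdist z z' \<le> norm (z - q) + \<phi> h + rdist q z'" if "q \<in> closure \<Omega>" "norm (z - q) < h" for q
      using h by (intro rdist_jump_strict[OF z that(1) z' that(2) _ _ wall(2)] far1) auto
    have via2: "rdist z z' \<le> norm (q - z') + \<phi> h + rdist z q" if "q \<in> closure \<Omega>" "norm (q - z') < h" for q
      using h rdist_jump_strict[OF z' that(1) z _ _ _ wall(2), of h] that far2
      by (simp add: rdist_commute norm_minus_commute)
    have d54: "rdist z z' \<le> 5/4 * h"
      using rdist_near[OF z z' _ h(3) \<phi>] wall(1) h by simp
    have "rdist z z' \<le> h + 6 * \<phi> h"
    proof (rule field_le_epsilon)
      fix e0 :: real assume e0: "e0 > 0"
      define e where "e = min (e0/10) (h/100)"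
      have e: "0 < e" "10 * e \<le> e0" "100 * e \<le> h" using e0 h by (auto simp: e_def)
      obtain a where a: "a \<in> closure \<Omega>" "norm (z - a) = h/3" "rdist z a + rdist a z' < rdist z z' + e"
        using rdist_sphere_point[OF z z' e(1), of z "h/3"] wall(1) h by auto
      have az': "2 * h/3 \<le> norm (z' - a)"
        using norm_triangle_ineq4[of "z - a" "z' - a"] a(2) wall(1) by simp
      obtain b where b: "b \<in> closure \<Omega>" "norm (z' - b) = h/3" "rdist z' b + rdist b a < rdist z' a + e"
        using rdist_sphere_point[OF z' a(1) e(1), of z' "h/3"] az' h by auto
      have lens: "norm (z - a) \<le> rdist z a" "norm (a - b) \<le> rdist a b" "norm (b - z') \<le> rdist b z'"
        "norm (a - z') \<le> rdist a z'"
        by (intro norm_le_rdist z z' a b)+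
      have tot: "rdist z a + rdist a b + rdist b z' < rdist z z' + 2 * e"
        using a(3) b(3) by (simp add: rdist_commute)
      have zb: "norm (z - b) \<le> rdist z a + rdist a b"
        using norm_triangle_ineq[of "z - a" "a - b"] lens by simp
      have bz': "norm (b - z') = h/3" using b(2) by (simp add: norm_minus_commute)
      have V1: "rdist z z' \<le> norm (z - b) + \<phi> h + rdist b z'"
        by (rule via1[OF b(1)]) (use zb tot lens bz' d54 e in linarith)
      have V2: "rdist z z' \<le> norm (a - z') + \<phi> h + rdist z a"
        by (rule via2[OF a(1)]) (use a tot lens d54 e in linarith)
      have "h \<le> norm (z - a) + norm (a - b) + norm (b - z')"
        using norm_triangle_ineq[of "z - b" "b - z'"] norm_triangle_ineq[of "z - a" "a - b"] wall(1) by simp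
      then have ab: "h/3 \<le> norm (a - b)" using a(2) bz' by simp
      have "norm (z - a) + norm (a - b) + norm (b - z')
          \<le> norm ((z - a) + (a - b) + (b - z')) + 4 * (\<phi> h + 2 * e)"
      proof (rule nearly_straight_join)
        show "norm (z - a) + norm (a - b) \<le> norm ((z - a) + (a - b)) + (\<phi> h + 2 * e)"
          using V1 tot lens by simp
        show "norm (a - b) + norm (b - z') \<le> norm ((a - b) + (b - z')) + (\<phi> h + 2 * e)"
          using V2 tot lens by simp
      qed (use a(2) bz' ab h in auto)
      then have sum: "norm (z - a) + norm (a - b) + norm (b - z') \<le> h + 4 * \<phi> h + 8 * e"
        using wall(1) by simp
      have "norm (a - z') \<le> norm (a - b) + norm (b - z')"
        using norm_triangle_ineq[of "a - b" "b - z'"] by simp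
      then have "rdist b z' \<le> \<phi> h + 2 * e + norm (b - z')"
        using V2 tot lens by linarith
      moreover have "norm (z - b) \<le> norm (z - a) + norm (a - b)"
        using norm_triangle_ineq[of "z - a" "a - b"] by simp
      ultimately show "rdist z z' \<le> h + 6 * \<phi> h + e0" using V1 sum e by linarith
    qed
    then show ?thesis using rdist_triangle[OF z z' y] wall(1) by simp
  qed
qed

text \<open>
Induction along the chain with a fixed point \<open>z\<close> from which the next jump will start. As long as the
chain stays within \<open>h\<close> of \<open>z\<close>, the jump is postponed. When it would leave, one jumps from \<open>z\<close> to the
last vertex. Two consecutive jumps then advance by more than \<open>h\<close>, which is what the subtracted term
\<^term>\<open>norm (z - p k)\<close> in the potential accounts for.
\<close>

lemma rdist_le_chain_length:
  assumes p: "\<And>i. i \<le> N \<Longrightarrow> p i \<in> closure \<Omega>" "\<And>i. i < N \<Longrightarrow> norm (p i - p (Suc i)) \<le> h"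
    and h: "0 < h" "h < h\<^sub>0" "h\<^sub>0 \<le> r" and \<phi>: "\<And>s. 0 < s \<Longrightarrow> s \<le> h\<^sub>0 \<Longrightarrow> \<phi> s \<le> s / 4"
  shows "rdist (p 0) (p N) \<le> (1 + 12 * \<phi> h / h) * (\<Sum>i<N. norm (p i - p (Suc i))) + 2 * h"
proof -
  define c where "c = 6 * \<phi> h / h"
  have c0: "0 \<le> c" using phi_nonneg[of h] h by (simp add: c_def)
  define T where "T k = (\<Sum>i=k..<N. norm (p i - p (Suc i)))" for k
  have T0: "0 \<le> T k" for k by (simp add: T_def sum_nonneg)
  define y where "y = p N"
  have y: "y \<in> closure \<Omega>" using p by (simp add: y_def)
  have close: "rdist z y \<le> 2 * h" if "z \<in> closure \<Omega>" "norm (z - y) \<le> h" for z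
    using rdist_near[OF that(1) y _ h(3) \<phi>] that h by simp
  have "\<forall>z\<in>closure \<Omega>. norm (z - p k) \<le> h \<longrightarrow>
      rdist z y \<le> (norm (z - p k) + T k) + c * (2 * (norm (z - p k) + T k) - norm (z - p k)) + 2 * h"
    if "k \<le> N" for k
    using that
  proof (induction rule: inc_induct)
    case base
    show ?case
    proof (intro ballI impI)
      fix z assume z: "z \<in> closure \<Omega>" "norm (z - p N) \<le> h"
      have "rdist z y \<le> 2 * h" using close z by (simp add: y_def)
      moreover have "0 \<le> norm (z - p N) + c * norm (z - p N)" using c0 by simp
      ultimately show "rdist z y \<le> (norm (z - p N) + T N) + c * (2 * (norm (z - p N) + T N) - norm (z - p N)) + 2 * h"
        by (simp add: T_def algebra_simps)
    qed
  next
    case (step k)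
    show ?case
    proof (intro ballI impI)
      fix z assume z: "z \<in> closure \<Omega>" and zk: "norm (z - p k) \<le> h"
      define a s where "a = norm (z - p k)" and "s = norm (p k - p (Suc k))"
      have s0: "0 \<le> s" by (simp add: s_def)
      have Tk: "T k = s + T (Suc k)"
        using step.hyps by (simp add: T_def s_def sum.atLeast_Suc_lessThan)
      have pk: "p k \<in> closure \<Omega>" using p step.hyps by simp
      have tri: "norm (z - p (Suc k)) \<le> a + s"
        using norm_triangle_ineq[of "z - p k" "p k - p (Suc k)"] by (simp add: a_def s_def)
      consider "norm (z - y) \<le> h" | "norm (z - p (Suc k)) \<le> h"
        | "h < norm (z - y)" "h < norm (z - p (Suc k))" by linarith
      then have "rdist z y \<le> (a + T k) + c * (2 * (a + T k) - a) + 2 * h"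
      proof cases
        case 1
        have a0: "0 \<le> a" by (simp add: a_def)
        have "0 \<le> c * (2 * (a + T k) - a)" using c0 T0[of k] a0 by simp
        then show ?thesis using close[OF z 1] T0[of k] a0 by linarith
      next
        case 2
        define a' where "a' = norm (z - p (Suc k))"
        have "rdist z y \<le> (a' + T (Suc k)) + c * (2 * (a' + T (Suc k)) - a') + 2 * h"
          using step.IH z 2 by (auto simp: a'_def)
        moreover have "c * (2 * (a' + T (Suc k)) - a') \<le> c * (2 * (a + T k) - a)"
          using c0 tri Tk s0 by (intro mult_left_mono) (auto simp: a'_def)
        ultimately show ?thesis using tri Tk unfolding a'_def by linarith
      next
        case 3
        have "rdist z y \<le> a + 6 * \<phi> h + rdist (p k) y"
          unfolding a_def by (rule rdist_jump[OF z pk y zk 3(1) h \<phi>])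
        moreover have "rdist (p k) y \<le> (s + T (Suc k)) + c * (2 * (s + T (Suc k)) - s) + 2 * h"
          using step.IH pk p(2)[OF step.hyps(2)] by (auto simp: s_def)
        moreover have "6 * \<phi> h = c * h" using h by (simp add: c_def)
        moreover have "c * h + c * (2 * (s + T (Suc k)) - s) \<le> c * (2 * (a + T k) - a)"
          unfolding distrib_left[symmetric]
          using c0 tri Tk 3(2) by (intro mult_left_mono) auto
        ultimately show ?thesis using Tk by simp
      qed
      then show "rdist z y \<le> (norm (z - p k) + T k) + c * (2 * (norm (z - p k) + T k) - norm (z - p k)) + 2 * h"
        by (simp add: a_def)
    qed
  qed
  from bspec[OF this[of 0] p(1)[of 0]]
  have "rdist (p 0) y \<le> T 0 + c * (2 * T 0) + 2 * h" using h by simp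
  moreover have "T 0 = (\<Sum>i<N. norm (p i - p (Suc i)))" by (simp add: T_def lessThan_atLeast0)
  ultimately show ?thesis by (simp add: y_def c_def algebra_simps)
qed

end

section \<open>Comparison with cones on a weighted graph\<close>

text \<open>
Suppose that \<open>u\<close> exceeds the cone somewhere in \<open>A\<close>, and take among the points of maximal excess one, \<open>y\<close>,
that is closest to the vertex of the cone. All upward slopes of \<open>u\<close> at \<open>y\<close> are bounded by \<open>M\<close>, so by the
equation no downward slope is steeper than \<open>- M\<close>. The predecessor of \<open>y\<close> on a shortest path
attains \<open>- M\<close>, so it has maximal excess as well, but it is closer to the vertex.
\<close>

lemma cone_comparison:
  fixes u d :: "'a \<Rightarrow> real" and w :: "'a \<Rightarrow> 'a \<Rightarrow> real"
  assumes fin: "finite V" and AV: "A \<subseteq> V" and M: "0 \<le> M" and w: "\<And>x y. 0 \<le> w x y"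
    and eq: "\<And>y. y \<in> A \<Longrightarrow> Min ((\<lambda>z. w y z * (u z - u y)) ` V) + Max ((\<lambda>z. w y z * (u z - u y)) ` V) = 0"
    and lip: "\<And>y z. y \<in> A \<Longrightarrow> z \<in> V \<Longrightarrow> 0 < w y z \<Longrightarrow> d z \<le> d y + 1 / w y z"
    and pred: "\<And>y. y \<in> A \<Longrightarrow> \<exists>z\<in>V. 0 < w y z \<and> d y = d z + 1 / w y z"
    and bd: "\<And>y z. y \<in> A \<Longrightarrow> z \<in> V \<Longrightarrow> z \<notin> A \<Longrightarrow> 0 < w y z \<Longrightarrow> u z \<le> a + M * d z"
    and y\<^sub>0: "y\<^sub>0 \<in> A"
  shows "u y\<^sub>0 \<le> a + M * d y\<^sub>0"
proof (rule ccontr)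
  assume neg: "\<not> u y\<^sub>0 \<le> a + M * d y\<^sub>0"
  have finA: "finite A" using fin AV finite_subset by blast
  define e where "e y = u y - M * d y" for y
  define m where "m = Max (e ` A)"
  have em: "e y \<le> m" if "y \<in> A" for y unfolding m_def using finA that by simp
  have am: "a < m" using em[OF y\<^sub>0] neg by (simp add: e_def)
  define S where "S = {y \<in> A. e y = m}"
  have "m \<in> e ` A" unfolding m_def using finA y\<^sub>0 by (intro Max_in) auto
  then have "S \<noteq> {}" by (auto simp: S_def)
  moreover have "finite S" using finA by (simp add: S_def)
  ultimately obtain y where yS: "y \<in> S" and ymin: "\<And>z. z \<in> S \<Longrightarrow> d y \<le> d z"
    using ex_min_if_finite[of "d ` S"] by (metis (no_types, lifting) finite_imageI image_iff image_is_empty not_le)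
  have yA: "y \<in> A" and ey: "e y = m" using yS by (auto simp: S_def)
  have ez: "e z \<le> m" "z \<notin> A \<Longrightarrow> e z < m" if "z \<in> V" "0 < w y z" for z
  proof -
    show lt: "z \<notin> A \<Longrightarrow> e z < m" using bd[OF yA that(1) _ that(2)] am by (simp add: e_def)
    then show "e z \<le> m" using em[of z] by (cases "z \<in> A") auto
  qed
  have slope: "u z - u y \<le> M * (d z - d y)" if "z \<in> V" "0 < w y z" for z
    using ez(1)[OF that] ey by (simp add: e_def algebra_simps)
  have up: "w y z * (u z - u y) \<le> M" if z: "z \<in> V" for z
  proof (cases "w y z = 0")
    case False
    then have wp: "0 < w y z" using w[of y z] by simp
    have "d z - d y \<le> 1 / w y z" using lip[OF yA z wp] by simp
    then have "u z - u y \<le> M * (1 / w y z)" using slope[OF z wp] M by (meson mult_left_mono order.trans)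
    then show ?thesis using wp by (simp add: field_simps)
  qed (use M in simp)
  have "Max ((\<lambda>z. w y z * (u z - u y)) ` V) \<le> M"
    using fin up yA AV by (subst Max_le_iff) auto
  then have lo: "- M \<le> w y z * (u z - u y)" if "z \<in> V" for z
  proof -
    have "Min ((\<lambda>z. w y z * (u z - u y)) ` V) \<le> w y z * (u z - u y)"
      using fin that by (intro Min_le) auto
    then show ?thesis
      using eq[OF yA] \<open>Max ((\<lambda>z. w y z * (u z - u y)) ` V) \<le> M\<close> by linarith
  qed
  obtain z where z: "z \<in> V" "0 < w y z" "d y = d z + 1 / w y z" using pred[OF yA] by blast
  have "M * (d z - d y) = - M / w y z" using z(3) by simp
  moreover have "- M / w y z \<le> u z - u y" using lo[OF z(1)] z(2) by (simp add: field_simps)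
  ultimately have "e z = m" using slope[OF z(1,2)] ey by (simp add: e_def algebra_simps)
  then have "z \<in> S" using ez(2)[OF z(1,2)] by (auto simp: S_def)
  then show False using ymin[of z] z(2,3) by (simp add: field_simps)
qed

locale kernel_graph =
  fixes \<eta> :: "real \<Rightarrow> real" and t\<^sub>0 h :: real and V :: "'a::euclidean_space set"
  assumes kernel: "kernel_assumption \<eta> t\<^sub>0" and h_pos: "0 < h" and finite_V: "finite V"
begin

abbreviation "w \<equiv> graph_weight \<eta> h"
abbreviation "egdist \<equiv> graph_dist \<eta> h V"

lemma t0: "0 < t\<^sub>0" "t\<^sub>0 \<le> 1" using kernel by (auto simp: kernel_assumption_def)

lemma sigma_pos: "0 < sigma_eta \<eta>" using kernel by (auto simp: kernel_assumption_def)

lemma w_commute: "w x y = w y x" by (simp add: graph_weight_def norm_minus_commute)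

lemma w_nonneg: "0 \<le> w x y"
proof -
  have "x \<noteq> y \<Longrightarrow> 0 < norm (x - y) / h" using h_pos by simp
  then show ?thesis 
    using kernel sigma_pos h_pos unfolding graph_weight_def kernel_assumption_def 
    by (auto intro!: divide_nonneg_nonneg mult_nonneg_nonneg)
qed

lemma norm_le_inverse_w:
  assumes "0 < w x y"
  shows "norm (x - y) \<le> h" "norm (x - y) \<le> 1 / w x y"
proof -
  have xy: "x \<noteq> y" using assms by (auto simp: graph_weight_def)
  define t where "t = norm (x - y) / h"
  have t: "0 < t" "norm (x - y) = t * h" using xy h_pos by (auto simp: t_def)
  have wt: "w x y = \<eta> t / (sigma_eta \<eta> * h)" using xy by (simp add: graph_weight_def t_def)
  have \<eta>t: "0 < \<eta> t"
  proof (rule ccontr)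
    assume "\<not> 0 < \<eta> t"
    then have "w x y \<le> 0" unfolding wt using sigma_pos h_pos by (simp add: divide_nonpos_pos)
    then show False using assms by simp
  qed
  then have "t \<le> 1" using kernel by (auto simp: kernel_assumption_def intro: leI)
  then show "norm (x - y) \<le> h" using t h_pos by simp
  have "t * \<eta> t \<le> sigma_eta \<eta>"
    unfolding sigma_eta_def using kernel t by (intro cSUP_upper) (auto simp: kernel_assumption_def)
  then show "norm (x - y) \<le> 1 / w x y"
    using \<eta>t h_pos t(2) by (simp add: wt field_simps)
qed

text \<open>
\<open>t\<^sub>0\<close> maximises \<^term>\<open>t * \<eta> t\<close>, so an edge of length \<open>t\<^sub>0 * h\<close> costs exactly its length.
Shorter edges are not more expensive because \<open>\<eta>\<close> is nonincreasing.
\<close>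

lemma w_short_edge:
  assumes "x \<noteq> y" "norm (x - y) \<le> t\<^sub>0 * h"
  shows "0 < w x y" "1 / w x y \<le> t\<^sub>0 * h"
proof -
  define t where "t = norm (x - y) / h"
  have t: "0 < t" "t \<le> t\<^sub>0" using assms h_pos by (auto simp: t_def field_simps)
  have wt: "w x y = \<eta> t / (sigma_eta \<eta> * h)" using assms by (simp add: graph_weight_def t_def)
  have s: "sigma_eta \<eta> = t\<^sub>0 * \<eta> t\<^sub>0" and mono: "\<eta> t\<^sub>0 \<le> \<eta> t" 
    using kernel t by (auto simp: kernel_assumption_def)
  have \<eta>: "0 < \<eta> t\<^sub>0" using s sigma_pos t0 by (simp add: zero_less_mult_iff)
  show "0 < w x y" unfolding wt using mono \<eta> sigma_pos h_pos by simp
  show "1 / w x y \<le> t\<^sub>0 * h"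
    unfolding wt using mono \<eta> sigma_pos h_pos t0 by (simp add: s field_simps)
qed

definition path_cost :: "nat \<Rightarrow> (nat \<Rightarrow> 'a) \<Rightarrow> ennreal" where
  "path_cost N p = (\<Sum>i=1..N. inverse (ennreal (w (p (i - 1)) (p i))))"

lemma egdist_self [simp]: "egdist x x = 0" by (simp add: graph_dist_def)

lemma egdist_le_path_cost:
  assumes "1 \<le> N" "\<And>i. i \<le> N \<Longrightarrow> p i \<in> V"
  shows "egdist (p 0) (p N) \<le> path_cost N p"
proof (cases "p 0 = p N")
  case False
  have "egdist (p 0) (p N) = Inf {\<Sum>i=1..M. inverse (ennreal (w (q (i - 1)) (q i))) | (M::nat) q.
                  1 \<le> M \<and> (\<forall>i\<le>M. q i \<in> V) \<and> q 0 = p 0 \<and> q M = p N}"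
    using False by (simp add: graph_dist_def)
  also have "\<dots> \<le> path_cost N p"
    using assms unfolding path_cost_def by (intro Inf_lower) blast
  finally show ?thesis .
qed simp

lemma egdist_greatest:
  assumes "x \<noteq> y" 
    "\<And>N p. 1 \<le> N \<Longrightarrow> (\<And>i. i \<le> N \<Longrightarrow> p i \<in> V) \<Longrightarrow> p 0 = x \<Longrightarrow> p N = y \<Longrightarrow> b \<le> path_cost N p"
  shows "b \<le> egdist x y"
  unfolding graph_dist_def using assms by (auto intro!: Inf_greatest simp: path_cost_def)

lemma path_cost_Suc: "path_cost (Suc N) p = path_cost N p + inverse (ennreal (w (p N) (p (Suc N))))"
  by (simp add: path_cost_def)

lemma egdist_edge:
  assumes "x \<in> V" "y \<in> V"
  shows "egdist x y \<le> inverse (ennreal (w x y))"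
  using egdist_le_path_cost[of 1 "\<lambda>i. if i = 0 then x else y"] assms by (simp add: path_cost_def)

lemma egdist_step:
  assumes x: "x \<in> V" and y: "y \<in> V" and z: "z \<in> V"
  shows "egdist x z \<le> egdist x y + inverse (ennreal (w y z))"
proof (cases "x = y")
  case True
  then show ?thesis using egdist_edge x z by simp
next
  case False
  show ?thesis
  proof (cases "inverse (ennreal (w y z)) = top")
    case fin: False
    have "egdist x z - inverse (ennreal (w y z)) \<le> egdist x y"
    proof (rule egdist_greatest[OF False])
      fix N :: nat and p assume p: "1 \<le> N" "\<And>i. i \<le> N \<Longrightarrow> p i \<in> V" "p 0 = x" "p N = y"
      define q where "q i = (if i \<le> N then p i else z)" for i
      have "egdist (q 0) (q (Suc N)) \<le> path_cost (Suc N) q"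
        using p z by (intro egdist_le_path_cost) (auto simp: q_def)
      also have "\<dots> = path_cost N p + inverse (ennreal (w y z))"
      proof -
        have "path_cost N q = path_cost N p"
          unfolding path_cost_def by (rule sum.cong) (auto simp: q_def)
        then show ?thesis using p by (simp add: path_cost_Suc q_def)
      qed
      finally show "egdist x z - inverse (ennreal (w y z)) \<le> path_cost N p"
        using p fin by (subst ennreal_minus_le_iff) (auto simp: q_def add.commute)
    qed
    then show ?thesis using fin by (subst (asm) ennreal_minus_le_iff) (auto simp: add.commute)
  qed simp
qed

lemma egdist_commute: "egdist x y = egdist y x"
proof -
  have "egdist x y \<le> egdist y x" if "x \<noteq> y" for x y
  proof (rule egdist_greatest)
    fix N :: nat and p assume p: "1 \<le> N" "\<And>i. i \<le> N \<Longrightarrow> p i \<in> V" "p 0 = y" "p N = x"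
    define q where "q i = p (N - i)" for i
    have "egdist (q 0) (q N) \<le> path_cost N q"
      using p by (intro egdist_le_path_cost) (auto simp: q_def)
    also have "\<dots> = path_cost N p"
      unfolding path_cost_def
    proof (subst sum.atLeastAtMost_rev, rule sum.cong)
      fix i assume i: "i \<in> {1..N}"
      then have "N - (N + 1 - i - 1) = i" "N - (N + 1 - i) = i - 1" by auto
      then show "inverse (ennreal (w (q (N + 1 - i - 1)) (q (N + 1 - i)))) = inverse (ennreal (w (p (i - 1)) (p i)))"
        unfolding q_def by (simp only: w_commute)
    qed simp
    finally show "egdist x y \<le> path_cost N p" using p by (simp add: q_def)
  qed (use that in auto)
  then show ?thesis by (metis antisym)
qed

text \<open>
There are infinitely many paths, so it is not immediate that the infimum is attained. Splitting off
the last edge reduces this to a minimum over the finitely many possible last but one vertices.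
\<close>

lemma egdist_predecessor:
  assumes x: "x \<in> V" and y: "y \<in> V" and xy: "x \<noteq> y" and fin: "egdist x y < top"
  obtains z where "z \<in> V" "0 < w z y" "egdist x y = egdist x z + inverse (ennreal (w z y))"
proof -
  define f where "f z = egdist x z + inverse (ennreal (w z y))" for z
  have "Min (f ` V) \<in> f ` V" using finite_V x by (intro Min_in) auto
  then obtain z where z: "z \<in> V" "Min (f ` V) = f z" by auto
  have "f z \<le> egdist x y"
  proof (rule egdist_greatest[OF xy])
    fix N :: nat and p assume p: "1 \<le> N" "\<And>i. i \<le> N \<Longrightarrow> p i \<in> V" "p 0 = x" "p N = y"
    obtain M where M: "N = Suc M" using p(1) by (cases N) auto
    have "egdist x (p M) \<le> path_cost M p"
    proof (cases "M = 0")
      case False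
      then show ?thesis using egdist_le_path_cost[of M p] p M by auto
    qed (use p in simp)
    then have "f (p M) \<le> path_cost N p"
      using p(4) M by (simp add: f_def path_cost_Suc add_right_mono)
    moreover have "f z \<le> f (p M)" using z(2) finite_V p(2)[of M] M by (metis Min_le finite_imageI image_eqI le_SucI order_refl)
    ultimately show "f z \<le> path_cost N p" by simp
  qed
  moreover have "egdist x y \<le> f z" unfolding f_def by (rule egdist_step[OF x z(1) y])
  ultimately have eq: "egdist x y = f z" by simp
  then have "inverse (ennreal (w z y)) < top" using fin by (simp add: f_def)
  then have "0 < w z y" using w_nonneg[of z y] by (cases "w z y = 0") auto
  then show thesis using that z(1) eq by (simp add: f_def)
qed

definition gdist :: "'a \<Rightarrow> 'a \<Rightarrow> real" where "gdist x y = enn2real (egdist x y)"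

lemma gdist_nonneg [simp]: "0 \<le> gdist x y" by (simp add: gdist_def)
lemma gdist_self [simp]: "gdist x x = 0" by (simp add: gdist_def)
lemma gdist_commute: "gdist x y = gdist y x" by (simp add: gdist_def egdist_commute)

end

locale connected_kernel_graph = kernel_graph +
  assumes egdist_finite: "\<And>x y. x \<in> V \<Longrightarrow> y \<in> V \<Longrightarrow> egdist x y < top"
begin

lemma ennreal_gdist: "x \<in> V \<Longrightarrow> y \<in> V \<Longrightarrow> ennreal (gdist x y) = egdist x y"
  unfolding gdist_def using egdist_finite by simp

lemma gdist_step:
  assumes "x \<in> V" "y \<in> V" "z \<in> V" "0 < w y z"
  shows "gdist x z \<le> gdist x y + 1 / w y z"
proof -
  have "ennreal (gdist x z) \<le> ennreal (gdist x y) + inverse (ennreal (w y z))"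
    using egdist_step[OF assms(1-3)] assms by (simp add: ennreal_gdist)
  also have "\<dots> = ennreal (gdist x y + 1 / w y z)"
    using assms(4) by (simp add: inverse_ennreal ennreal_plus inverse_eq_divide)
  finally show ?thesis using assms(4) by (subst (asm) ennreal_le_iff) auto
qed

lemma gdist_predecessor:
  assumes "x \<in> V" "y \<in> V" "x \<noteq> y"
  shows "\<exists>z\<in>V. 0 < w y z \<and> gdist x y = gdist x z + 1 / w y z"
proof -
  obtain z where z: "z \<in> V" "0 < w z y" "egdist x y = egdist x z + inverse (ennreal (w z y))"
    using egdist_predecessor[OF assms egdist_finite] assms by blast
  have "ennreal (gdist x y) = ennreal (gdist x z) + inverse (ennreal (w z y))"
    using z assms by (simp add: ennreal_gdist)
  also have "\<dots> = ennreal (gdist x z + 1 / w z y)"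
    using z by (simp add: inverse_ennreal ennreal_plus inverse_eq_divide)
  finally have "gdist x y = gdist x z + 1 / w z y" using z(2) by (subst (asm) ennreal_inj) auto
  then show ?thesis using z w_commute by (metis (no_types))
qed

lemma solution_below_cone:
  assumes sol: "solves_graph_inf_laplace \<eta> h V O\<^sub>n g u" and A: "A \<subseteq> V - O\<^sub>n - {x}"
    and x: "x \<in> V" and M: "0 \<le> M"
    and bd: "\<And>y z. y \<in> A \<Longrightarrow> z \<in> V \<Longrightarrow> z \<notin> A \<Longrightarrow> 0 < w y z \<Longrightarrow> u z \<le> a + M * gdist x z"
    and y: "y \<in> A"
  shows "u y \<le> a + M * gdist x y"
proof (rule cone_comparison[where V = V and A = A and w = w])
  show "Min ((\<lambda>z. w y z * (u z - u y)) ` V) + Max ((\<lambda>z. w y z * (u z - u y)) ` V) = 0" if "y \<in> A" for y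
    using sol A that unfolding solves_graph_inf_laplace_def by blast
  show "gdist x z \<le> gdist x y + 1 / w y z" if "y \<in> A" "z \<in> V" "0 < w y z" for y z
    using that A x by (intro gdist_step) auto
  show "\<exists>z\<in>V. 0 < w y z \<and> gdist x y = gdist x z + 1 / w y z" if "y \<in> A" for y
    using that A x by (intro gdist_predecessor) auto
qed (use finite_V A M w_nonneg bd y in auto)

lemma solution_uminus:
  assumes "solves_graph_inf_laplace \<eta> h V O\<^sub>n g u" "O\<^sub>n \<subseteq> V"
  shows "solves_graph_inf_laplace \<eta> h V O\<^sub>n (\<lambda>x. - g x) (\<lambda>x. - u x)"
  unfolding solves_graph_inf_laplace_def
proof (intro conjI ballI)
  fix x assume x: "x \<in> V - O\<^sub>n"
  define S where "S = (\<lambda>y. w x y * (u y - u x)) ` V"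
  have S: "finite S" "S \<noteq> {}" using finite_V x by (auto simp: S_def)
  have im: "(\<lambda>y. w x y * (- u y - - u x)) ` V = uminus ` S"
    by (auto simp: S_def image_image algebra_simps intro!: image_cong)
  have "Min S + Max S = 0" using assms x by (simp add: solves_graph_inf_laplace_def S_def)
  then show "Min ((\<lambda>y. w x y * (- u y - - u x)) ` V) + Max ((\<lambda>y. w x y * (- u y - - u x)) ` V) = 0"
    unfolding im minus_Max_eq_Min[OF S, symmetric] minus_Min_eq_Max[OF S, symmetric] by simp
qed (use assms in \<open>auto simp: solves_graph_inf_laplace_def\<close>)

lemma finite_difference_quotients:
  assumes "finite O\<^sub>n"
  shows "finite {enn2real (ennreal \<bar>g x - g y\<bar> / egdist x y) | x y. x \<in> O\<^sub>n \<and> y \<in> O\<^sub>n \<and> x \<noteq> y}"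
proof (rule finite_subset)
  show "{enn2real (ennreal \<bar>g x - g y\<bar> / egdist x y) | x y. x \<in> O\<^sub>n \<and> y \<in> O\<^sub>n \<and> x \<noteq> y}
      \<subseteq> (\<lambda>(x, y). enn2real (ennreal \<bar>g x - g y\<bar> / egdist x y)) ` (O\<^sub>n \<times> O\<^sub>n)" by auto
qed (use assms in simp)

lemma graph_Lip_nonneg:
  assumes "finite O\<^sub>n"
  shows "0 \<le> graph_Lip \<eta> h V O\<^sub>n g"
  unfolding graph_Lip_def using finite_difference_quotients[OF assms] by (intro Max_ge) auto

lemma graph_Lip_labels:
  assumes sub: "O\<^sub>n \<subseteq> V" and x: "x \<in> O\<^sub>n" and y: "y \<in> O\<^sub>n"
  shows "\<bar>g x - g y\<bar> \<le> graph_Lip \<eta> h V O\<^sub>n g * gdist x y"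
proof (cases "x = y")
  case False
  have fin: "finite O\<^sub>n" using sub finite_V finite_subset by blast
  obtain z where z: "z \<in> V" "0 < w y z" "gdist x y = gdist x z + 1 / w y z"
    using gdist_predecessor[of x y] x y sub False by auto
  then have Dpos: "0 < gdist x y" using gdist_nonneg[of x z] by (simp add: add_nonneg_pos del: gdist_nonneg)
  have "enn2real (ennreal \<bar>g x - g y\<bar> / egdist x y) \<le> graph_Lip \<eta> h V O\<^sub>n g"
    unfolding graph_Lip_def using finite_difference_quotients[OF fin] x y False by (intro Max_ge) auto
  moreover have "egdist x y = ennreal (gdist x y)" by (rule ennreal_gdist[symmetric]) (use x y sub in auto)
  ultimately have "\<bar>g x - g y\<bar> / gdist x y \<le> graph_Lip \<eta> h V O\<^sub>n g"
    using Dpos by (simp add: divide_ennreal)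
  then show ?thesis using Dpos by (simp add: pos_divide_le_eq)
qed simp

text \<open>
Comparison with the cones at the labels extends the Lipschitz bound from the labels to pairs of a
label and a vertex. Comparison with the cones at an arbitrary vertex then extends it to all pairs.
\<close>

lemma solution_lipschitz:
  assumes sol: "solves_graph_inf_laplace \<eta> h V O\<^sub>n g u" and sub: "O\<^sub>n \<subseteq> V" "O\<^sub>n \<noteq> {}"
    and x: "x \<in> V" and y: "y \<in> V"
  shows "\<bar>u x - u y\<bar> \<le> graph_Lip \<eta> h V O\<^sub>n g * gdist x y"
proof -
  define K where "K = graph_Lip \<eta> h V O\<^sub>n g"
  have K: "0 \<le> K" unfolding K_def using sub finite_V finite_subset by (intro graph_Lip_nonneg) blast
  have ug: "u o' = g o'" if "o' \<in> O\<^sub>n" for o' using sol that by (simp add: solves_graph_inf_laplace_def)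
  have lab: "\<bar>u a - u b\<bar> \<le> K * gdist a b" if "a \<in> O\<^sub>n" "b \<in> O\<^sub>n" for a b
    unfolding K_def using graph_Lip_labels[OF sub(1) that] ug that by simp
  have up: "v z \<le> v b + K * gdist b z" 
    if "solves_graph_inf_laplace \<eta> h V O\<^sub>n f v" and b: "b \<in> V" 
      and v: "\<And>c. c \<in> O\<^sub>n \<Longrightarrow> v c \<le> v b + K * gdist b c" and z: "z \<in> V" for f v b z
  proof (cases "z \<in> V - O\<^sub>n - {b}")
    case True
    show ?thesis
    proof (rule solution_below_cone[OF that(1) _ b K _ True])
      fix z' assume "z' \<in> V" "z' \<notin> V - O\<^sub>n - {b}"
      then show "v z' \<le> v b + K * gdist b z'" using v by (cases "z' = b") auto
    qed auto
  next
    case False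
    then show ?thesis using v z by (cases "z = b") auto
  qed
  note neg = solution_uminus[OF sol sub(1)]
  have l1: "\<bar>u z - u b\<bar> \<le> K * gdist b z" if b: "b \<in> O\<^sub>n" and z: "z \<in> V" for b z
  proof -
    have "u z \<le> u b + K * gdist b z"
    proof (rule up[OF sol _ _ z])
      show "u c \<le> u b + K * gdist b c" if "c \<in> O\<^sub>n" for c using lab[OF b that] by linarith
    qed (use b sub in auto)
    moreover have "- u z \<le> - u b + K * gdist b z"
    proof (rule up[OF neg _ _ z])
      show "- u c \<le> - u b + K * gdist b c" if "c \<in> O\<^sub>n" for c using lab[OF b that] by linarith
    qed (use b sub in auto)
    ultimately show ?thesis by linarith
  qed
  have "u z \<le> u b + K * gdist b z" if b: "b \<in> V" and z: "z \<in> V" for b z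
  proof (rule up[OF sol b _ z])
    show "u c \<le> u b + K * gdist b c" if "c \<in> O\<^sub>n" for c 
      using l1[OF that b] by (simp add: gdist_commute)
  qed
  from this[OF x y] this[OF y x] show ?thesis unfolding K_def by (simp add: gdist_commute abs_le_iff)
qed

end

section \<open>Graph distance against geodesic distance\<close>

locale approximating_graph =
  geo_domain \<Omega> \<phi> r + kernel_graph \<eta> t\<^sub>0 h V
  for \<Omega> :: "'a::euclidean_space set" and \<phi> r \<eta> t\<^sub>0 h and V :: "'a set" +
  fixes \<delta> :: real
  assumes \<delta>_pos: "0 < \<delta>" and V_sub: "V \<subseteq> closure \<Omega>"
    and resolves: "\<And>x. x \<in> closure \<Omega> \<Longrightarrow> \<exists>v\<in>V. norm (x - v) \<le> \<delta>"
    and h_le_r: "h \<le> r" and \<phi>_le: "\<And>s. 0 < s \<Longrightarrow> s \<le> h \<Longrightarrow> \<phi> s \<le> s / 4"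
    and \<delta>_le: "4 * \<delta> \<le> t\<^sub>0 * h"
begin

lemma \<delta>_le_h: "4 * \<delta> \<le> h"
proof -
  have "t\<^sub>0 * h \<le> 1 * h" using t0 h_pos by (intro mult_right_mono) auto
  then show ?thesis using \<delta>_le by linarith
qed

lemma near_vertex:
  assumes "x \<in> closure \<Omega>"
  obtains v where "v \<in> V" "v \<in> closure \<Omega>" "norm (x - v) \<le> \<delta>" "rdist x v \<le> 5/4 * \<delta>"
proof -
  obtain v where v: "v \<in> V" "norm (x - v) \<le> \<delta>" using resolves[OF assms] by blast
  have vc: "v \<in> closure \<Omega>" using v V_sub by auto
  have "rdist x v \<le> 5/4 * norm (x - v)"
    using v(2) \<delta>_le_h \<delta>_pos by (intro rdist_near[OF assms vc _ h_le_r \<phi>_le]) auto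
  then show thesis using that v vc by simp
qed

lemma egdist_short:
  assumes "x \<in> V" "y \<in> V" "norm (x - y) \<le> t\<^sub>0 * h"
  shows "egdist x y \<le> ennreal (t\<^sub>0 * h)"
proof (cases "x = y")
  case False
  note w = w_short_edge[OF False assms(3)]
  have "egdist x y \<le> inverse (ennreal (w x y))" by (rule egdist_edge[OF assms(1,2)])
  also have "\<dots> = ennreal (1 / w x y)" using w by (simp add: inverse_ennreal inverse_eq_divide)
  also have "\<dots> \<le> ennreal (t\<^sub>0 * h)" using w by (intro ennreal_leI)
  finally show ?thesis .
qed simp

lemma egdist_append_short:
  assumes "x \<in> V" "y \<in> V" "z \<in> V" "norm (y - z) \<le> t\<^sub>0 * h"
  shows "egdist x z \<le> egdist x y + ennreal (t\<^sub>0 * h)"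
proof (cases "y = z")
  case True
  then show ?thesis by (simp add: add_increasing2)
next
  case False
  note w = w_short_edge[OF False assms(4)]
  have "inverse (ennreal (w y z)) = ennreal (1 / w y z)" using w by (simp add: inverse_ennreal inverse_eq_divide)
  also have "\<dots> \<le> ennreal (t\<^sub>0 * h)" using w by (intro ennreal_leI)
  finally show ?thesis using egdist_step[OF assms(1-3)] by (meson add_left_mono order.trans)
qed

text \<open>
The induction peels off a piece of Euclidean length \<open>t\<^sub>0 * h - 2 * \<delta>\<close> from the far end of a nearly
shortest curve. The correction \<open>2 * \<delta>\<close> allows for the two vertices that replace the end points.
\<close>

lemma egdist_le_steps:
  assumes y: "y \<in> V"
  shows "q \<in> closure \<Omega> \<Longrightarrow> v \<in> V \<Longrightarrow> norm (q - v) \<le> \<delta> \<Longrightarrow> rdist q y < (real n + 1) * (t\<^sub>0 * h - 2 * \<delta>)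
     \<Longrightarrow> egdist y v \<le> ennreal ((real n + 1) * (t\<^sub>0 * h))"
proof (induction n arbitrary: q v)
  define s where "s = t\<^sub>0 * h - 2 * \<delta>"
  have th: "0 < t\<^sub>0 * h" using t0 h_pos by simp
  have s: "0 < s" using \<delta>_le \<delta>_pos th by (simp add: s_def)
  have yc: "y \<in> closure \<Omega>" using y V_sub by auto
  have single: "egdist y v \<le> ennreal (t\<^sub>0 * h)" if "v \<in> V" "norm (q - v) \<le> \<delta>" "norm (q - y) \<le> s" for q v
  proof -
    have "norm (y - v) \<le> norm (q - y) + norm (q - v)"
      using norm_triangle_ineq4[of "q - v" "q - y"] by simp
    then show ?thesis using that \<delta>_pos by (intro egdist_short y) (auto simp: s_def)
  qed
  {
    case 0
    have "norm (q - y) \<le> s" using 0 norm_le_rdist[OF 0(1) yc] by (simp add: s_def)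
    then show ?case using single 0 by simp
  next
    case (Suc n)
    show ?case
    proof (cases "norm (q - y) \<le> s")
      case True
      have "egdist y v \<le> ennreal (t\<^sub>0 * h)" using single Suc.prems True by blast
      also have "\<dots> \<le> ennreal ((real (Suc n) + 1) * (t\<^sub>0 * h))"
        using th mult_right_mono[of 1 "real (Suc n) + 1" "t\<^sub>0 * h"] by (intro ennreal_leI) simp
      finally show ?thesis .
    next
      case False
      define e where "e = (real (Suc n) + 1) * s - rdist q y"
      have e: "0 < e" using Suc.prems by (simp add: e_def s_def)
      obtain p where p: "p \<in> closure \<Omega>" "norm (q - p) = s" "rdist q p + rdist p y < rdist q y + e"
        using rdist_sphere_point[OF Suc.prems(1) yc e, of q s] s False by auto
      have "s \<le> rdist q p" using norm_le_rdist[OF Suc.prems(1) p(1)] p(2) by simp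
      then have "rdist p y < (real n + 1) * s" using p(3) by (simp add: e_def algebra_simps)
      moreover obtain v' where v': "v' \<in> V" "norm (p - v') \<le> \<delta>" using near_vertex[OF p(1)] by blast
      ultimately have IH: "egdist y v' \<le> ennreal ((real n + 1) * (t\<^sub>0 * h))"
        using Suc.IH[OF p(1)] by (simp add: s_def)
      have "norm (v' - v) \<le> norm (p - v') + norm (q - p) + norm (q - v)"
        using norm_triangle_ineq4[of "q - v" "q - v'"] norm_triangle_ineq[of "q - p" "p - v'"] by simp
      then have "norm (v' - v) \<le> t\<^sub>0 * h" using v'(2) p(2) Suc.prems(3) by (simp add: s_def)
      then have "egdist y v \<le> egdist y v' + ennreal (t\<^sub>0 * h)" by (intro egdist_append_short y v' Suc.prems)
      also have "\<dots> \<le> ennreal ((real n + 1) * (t\<^sub>0 * h)) + ennreal (t\<^sub>0 * h)"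
        using IH by (intro add_right_mono)
      also have "\<dots> = ennreal ((real (Suc n) + 1) * (t\<^sub>0 * h))"
      proof -
        have "(real (Suc n) + 1) * (t\<^sub>0 * h) = (real n + 1) * (t\<^sub>0 * h) + t\<^sub>0 * h"
          by (simp add: algebra_simps)
        then show ?thesis using th by (simp only:) (subst ennreal_plus, auto)
      qed
      finally show ?thesis .
    qed
  }
qed

lemma egdist_upper:
  assumes x: "x \<in> V" and y: "y \<in> V"
  shows "egdist x y \<le> ennreal ((1 + 4 * \<delta> / (t\<^sub>0 * h)) * rdist x y + h)"
proof -
  define T s where "T = t\<^sub>0 * h" and "s = t\<^sub>0 * h - 2 * \<delta>"
  have T: "0 < T" "T \<le> h" using t0 h_pos mult_right_mono[of t\<^sub>0 1 h] by (auto simp: T_def)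
  have s: "0 < s" "2 * s \<ge> T" using \<delta>_le \<delta>_pos T by (auto simp: s_def T_def mult.commute)
  define n where "n = nat \<lfloor>rdist x y / s\<rfloor>"
  have n: "rdist x y / s < real n + 1" "real n \<le> rdist x y / s"
    using s rdist_nonneg[of x y] unfolding n_def by (simp_all add: of_nat_nat del: rdist_nonneg)
  have "rdist y x < (real n + 1) * s" using n(1) s by (simp add: rdist_commute pos_divide_less_eq)
  then have "egdist x y \<le> ennreal ((real n + 1) * T)"
    using egdist_le_steps[OF x, of y y n] y V_sub \<delta>_pos by (auto simp: s_def T_def)
  also have "\<dots> \<le> ennreal ((1 + 4 * \<delta> / T) * rdist x y + h)"
  proof (rule ennreal_leI)
    have "T / s \<le> 1 + 4 * \<delta> / T"
    proof -
      have "T * T \<le> (T + 4 * \<delta>) * s"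
        using \<delta>_le \<delta>_pos mult_left_mono[of "4 * \<delta>" T "2 * \<delta>"] by (simp add: s_def T_def algebra_simps)
      then have "T / s \<le> (T + 4 * \<delta>) / T" using s T by (simp add: divide_simps mult.commute)
      then show ?thesis using T by (simp add: add_divide_distrib)
    qed
    then have "rdist x y * (T / s) \<le> rdist x y * (1 + 4 * \<delta> / T)" by (intro mult_left_mono) auto
    moreover have "real n * T \<le> rdist x y / s * T" using n(2) T by (intro mult_right_mono) auto
    ultimately show "(real n + 1) * T \<le> (1 + 4 * \<delta> / T) * rdist x y + h"
      using T(2) by (simp add: algebra_simps)
  qed
  finally show ?thesis by (simp add: T_def)
qed

end

sublocale approximating_graph \<subseteq> connected_kernel_graph
proof
  show "egdist x y < top" if "x \<in> V" "y \<in> V" for x y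
    using egdist_upper[OF that] ennreal_less_top le_less_trans by blast
qed

context approximating_graph
begin

lemma gdist_upper:
  assumes "x \<in> V" "y \<in> V"
  shows "gdist x y \<le> (1 + 4 * \<delta> / (t\<^sub>0 * h)) * rdist x y + h" "gdist x y \<le> 2 * rdist x y + h"
proof -
  have q: "0 \<le> 4 * \<delta> / (t\<^sub>0 * h)" "4 * \<delta> / (t\<^sub>0 * h) \<le> 1"
    using \<delta>_pos \<delta>_le t0 h_pos by (auto simp: mult.commute)
  have "0 \<le> (1 + 4 * \<delta> / (t\<^sub>0 * h)) * rdist x y + h" using q h_pos by simp
  then show 1: "gdist x y \<le> (1 + 4 * \<delta> / (t\<^sub>0 * h)) * rdist x y + h"
    using egdist_upper[OF assms] ennreal_gdist[OF assms] by (metis ennreal_le_iff)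
  have "(1 + 4 * \<delta> / (t\<^sub>0 * h)) * rdist x y \<le> 2 * rdist x y" using q by (intro mult_right_mono) auto
  then show "gdist x y \<le> 2 * rdist x y + h" using 1 by simp
qed

text \<open>
An edge costs at least its length, so the cost of a path bounds the length of a chain of jumps.
\<close>

lemma gdist_lower:
  assumes x: "x \<in> V" and y: "y \<in> V"
    and h: "h < h\<^sub>0" "h\<^sub>0 \<le> r" and \<phi>: "\<And>s. 0 < s \<Longrightarrow> s \<le> h\<^sub>0 \<Longrightarrow> \<phi> s \<le> s / 4"
  shows "rdist x y \<le> (1 + 12 * \<phi> h / h) * gdist x y + 2 * h"
proof -
  define P where "P = 1 + 12 * \<phi> h / h"
  have P: "0 < P" using phi_nonneg[of h] h_pos by (simp add: P_def add_pos_nonneg)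
  have "(rdist x y - 2 * h) / P \<le> gdist x y"
  proof (cases "x = y")
    case True
    then show ?thesis using rdist_self[of x] x V_sub h_pos P by (auto simp: divide_nonpos_pos)
  next
    case False
    have "ennreal ((rdist x y - 2 * h) / P) \<le> egdist x y"
    proof (rule egdist_greatest[OF False])
      fix N :: nat and p assume p: "1 \<le> N" "\<And>i. i \<le> N \<Longrightarrow> p i \<in> V" "p 0 = x" "p N = y"
      show "ennreal ((rdist x y - 2 * h) / P) \<le> path_cost N p"
      proof (cases "\<exists>i\<in>{1..N}. w (p (i - 1)) (p i) = 0")
        case True
        then obtain i where i: "i \<in> {1..N}" "w (p (i - 1)) (p i) = 0" by blast
        then have "inverse (ennreal (w (p (i - 1)) (p i))) = top" by simp
        then have "path_cost N p = top"
          unfolding path_cost_def using i(1) by (subst ennreal_sum_eq_top) auto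
        then show ?thesis by simp
      next
        case pos: False
        have wp: "0 < w (p i) (p (Suc i))" if "i < N" for i
          using pos w_nonneg[of "p i" "p (Suc i)"] that by (force simp: less_le)
        have "rdist (p 0) (p N) \<le> P * (\<Sum>i<N. norm (p i - p (Suc i))) + 2 * h"
          unfolding P_def
          by (rule rdist_le_chain_length[OF _ _ h_pos h \<phi>]) (use p(2) V_sub norm_le_inverse_w(1)[OF wp] in auto)
        also have "(\<Sum>i<N. norm (p i - p (Suc i))) \<le> (\<Sum>i<N. 1 / w (p i) (p (Suc i)))"
          by (intro sum_mono norm_le_inverse_w(2) wp) auto
        finally have "(rdist x y - 2 * h) / P \<le> (\<Sum>i<N. 1 / w (p i) (p (Suc i)))"
          using P p by (simp add: pos_divide_le_eq mult.commute mult_left_mono)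
        then have "ennreal ((rdist x y - 2 * h) / P) \<le> ennreal (\<Sum>i<N. 1 / w (p i) (p (Suc i)))"
          by (rule ennreal_leI)
        also have "\<dots> = (\<Sum>i<N. ennreal (1 / w (p i) (p (Suc i))))"
          using w_nonneg by (subst sum_ennreal) auto
        also have "\<dots> = (\<Sum>i<N. inverse (ennreal (w (p i) (p (Suc i)))))"
          using wp by (intro sum.cong) (auto simp: inverse_ennreal inverse_eq_divide)
        also have "\<dots> = path_cost N p"
          unfolding path_cost_def by (simp add: sum.atLeast1_atMost_eq)
        finally show ?thesis .
      qed
    qed
    then show ?thesis using ennreal_gdist[OF x y] by (metis gdist_nonneg ennreal_le_iff)
  qed
  then have "rdist x y - 2 * h \<le> P * gdist x y" using P by (simp add: pos_divide_le_eq mult.commute)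
  then show ?thesis unfolding P_def[symmetric] by linarith
qed

end

section \<open>The one-sided consistency estimate\<close>

lemma (in geo_domain) geo_cball_iff_bounds:
  assumes x: "x \<in> closure \<Omega>"
  shows "y \<in> geo_cball \<Omega> x e \<Longrightarrow> y \<in> closure \<Omega> \<and> rdist x y \<le> e"
    and "y \<in> closure \<Omega> \<Longrightarrow> rdist x y < e \<Longrightarrow> y \<in> geo_cball \<Omega> x e"
proof -
  assume y: "y \<in> geo_cball \<Omega> x e"
  then have yb: "y \<in> closure (geo_ball \<Omega> x e)" by (simp add: geo_cball_def)
  moreover have "geo_ball \<Omega> x e \<subseteq> closure \<Omega>" by (auto simp: geo_ball_def)
  ultimately have yc: "y \<in> closure \<Omega>" by (metis closure_closure closure_mono subsetD)
  have "rdist x y \<le> e"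
  proof (rule field_le_epsilon)
    fix d :: real assume d: "0 < d"
    obtain \<rho> where \<rho>: "0 < \<rho>" 
      "\<And>x y. x \<in> closure \<Omega> \<Longrightarrow> y \<in> closure \<Omega> \<Longrightarrow> norm (x - y) < \<rho> \<Longrightarrow> rdist x y < d"
      using rdist_small_ball[OF d] by metis
    obtain z where z: "z \<in> geo_ball \<Omega> x e" "dist z y < \<rho>"
      using yb \<rho>(1) closure_approachable by metis
    have zc: "z \<in> closure \<Omega>" and "geo_dist \<Omega> x z < ennreal e" using z by (auto simp: geo_ball_def)
    then have "rdist x z < e" using rdist_less_iff x by simp
    moreover have "rdist z y < d" using \<rho>(2)[OF zc yc] z by (simp add: dist_norm)
    ultimately show "rdist x y \<le> e + d" using rdist_triangle[OF x zc yc] by simp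
  qed
  then show "y \<in> closure \<Omega> \<and> rdist x y \<le> e" using yc by simp
next
  assume "y \<in> closure \<Omega>" "rdist x y < e"
  then show "y \<in> geo_cball \<Omega> x e"
    using rdist_less_iff[OF x] closure_subset[of "geo_ball \<Omega> x e"]
    by (auto simp: geo_cball_def geo_ball_def)
qed

context approximating_graph
begin

text \<open>
The supremum is over a finite nonempty set and thus attained. The ball is the closure of an open
geodesic ball, which is why membership is only known for strict inequality.
\<close>

lemma upper_ext_bounds:
  assumes x: "x \<in> closure \<Omega>" and e: "2 * h < e"
  obtains z where "z \<in> V" "rdist x z \<le> e" "upper_ext \<Omega> V e u x = u z"
    "\<And>v. v \<in> V \<Longrightarrow> rdist x v < e \<Longrightarrow> u v \<le> upper_ext \<Omega> V e u x"
proof -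
  let ?B = "geo_cball \<Omega> x e \<inter> V"
  obtain v where v: "v \<in> V" "v \<in> closure \<Omega>" "rdist x v \<le> 5/4 * \<delta>" using near_vertex[OF x] by metis
  have "rdist x v < e" using v(3) \<delta>_le_h e h_pos by simp
  then have ne: "?B \<noteq> {}" using geo_cball_iff_bounds(2)[OF x] v by blast
  have fin: "finite ?B" using finite_V by simp
  have sup: "upper_ext \<Omega> V e u x = Max (u ` ?B)"
    unfolding upper_ext_def using fin ne by (subst cSup_eq_Max) auto
  have "Max (u ` ?B) \<in> u ` ?B" using fin ne by (intro Max_in) auto
  then obtain z where z: "z \<in> ?B" "Max (u ` ?B) = u z" by auto
  show thesis
  proof (rule that)
    show "z \<in> V" "rdist x z \<le> e" using z geo_cball_iff_bounds(1)[OF x] by auto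
    show "upper_ext \<Omega> V e u x = u z" using sup z by simp
    show "u v \<le> upper_ext \<Omega> V e u x" if "v \<in> V" "rdist x v < e" for v
    proof -
      have "v \<in> ?B" using that geo_cball_iff_bounds(2)[OF x] V_sub by auto
      then show ?thesis unfolding sup using fin by (intro Max_ge) auto
    qed
  qed
qed

text \<open>
The argument with the cone described at the beginning. Two cases need no cone. For \<open>h \<ge> h\<^sub>0\<close> the
diameter bound \<open>B\<close> controls the oscillation of \<open>u\<close>. For \<open>\<epsilon> < 5 * h\<close>, where the distance \<open>R\<close> below may fail
to be positive, the local bounds \<open>U_le\<close> and \<open>U_ge\<close> suffice.
\<close>

lemma one_sided_estimate:
  fixes u :: "'a \<Rightarrow> real"
  assumes sol: "solves_graph_inf_laplace \<eta> h V O\<^sub>n g u" and sub: "O\<^sub>n \<subseteq> V" "O\<^sub>n \<noteq> {}"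
    and x0: "x\<^sub>0 \<in> closure \<Omega>" and far: "\<And>o'. o' \<in> O\<^sub>n \<Longrightarrow> 2 * \<epsilon> < rdist x\<^sub>0 o'"
    and \<epsilon>: "2 * h < \<epsilon>"
    and h0: "0 < h\<^sub>0" "h\<^sub>0 \<le> r" and \<phi>: "\<And>s. 0 < s \<Longrightarrow> s \<le> h\<^sub>0 \<Longrightarrow> \<phi> s \<le> s / 4"
    and B: "0 < B" "\<And>x y. x \<in> closure \<Omega> \<Longrightarrow> y \<in> closure \<Omega> \<Longrightarrow> rdist x y \<le> B"
  shows "- nonlocal_inf_laplacian \<Omega> \<epsilon> (upper_ext \<Omega> V \<epsilon> u) x\<^sub>0
      \<le> graph_Lip \<eta> h V O\<^sub>n g * (240 + 40 / t\<^sub>0 + 2 * B / h\<^sub>0) *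
          (\<delta> / (h * \<epsilon>) + h / \<epsilon>\<^sup>2 + \<phi> h / (h * \<epsilon>))"
proof -
  define K where "K = graph_Lip \<eta> h V O\<^sub>n g"
  have K: "0 \<le> K" unfolding K_def using sub finite_V finite_subset by (intro graph_Lip_nonneg) blast
  have lip: "\<bar>u x - u y\<bar> \<le> K * gdist x y" if "x \<in> V" "y \<in> V" for x y
    unfolding K_def by (rule solution_lipschitz[OF sol sub that])
  have inc: "v \<in> closure \<Omega>" if "v \<in> V" for v using that V_sub by auto
  have \<epsilon>0: "0 < \<epsilon>" using \<epsilon> h_pos by simp
  have \<delta>h: "4 * \<delta> \<le> h" by (rule \<delta>_le_h)
  have \<phi>h: "0 \<le> \<phi> h" "4 * \<phi> h \<le> h" using phi_nonneg[of h] \<phi>_le[of h] h_pos by auto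
  define U where "U = upper_ext \<Omega> V \<epsilon> u"
  let ?B = "geo_cball \<Omega> x\<^sub>0 \<epsilon>"
  define S where "S = (SUP y\<in>?B. U y)"
  define I where "I = (INF y\<in>?B. U y)"
  have x0B: "x\<^sub>0 \<in> ?B" using geo_cball_iff_bounds(2)[OF x0 x0] \<epsilon>0 rdist_self[OF x0] by simp
  obtain c where c: "c \<in> V" "rdist x\<^sub>0 c \<le> 5/4 * \<delta>" using near_vertex[OF x0] by metis
  have Uz: "\<exists>z\<in>V. rdist x z \<le> \<epsilon> \<and> U x = u z" if "x \<in> closure \<Omega>" for x
    using upper_ext_bounds[OF that \<epsilon>] unfolding U_def by metis
  have Uge: "u v \<le> U x" if "x \<in> closure \<Omega>" "v \<in> V" "rdist x v < \<epsilon>" for x v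
    using upper_ext_bounds[OF that(1) \<epsilon>] that unfolding U_def by metis
  have Bb: "x \<in> closure \<Omega>" "rdist x\<^sub>0 x \<le> \<epsilon>" if "x \<in> ?B" for x
    using geo_cball_iff_bounds(1)[OF x0 that] by auto
  have gdist_far: "gdist c z \<le> 5 * \<epsilon>" if "z \<in> V" "rdist x\<^sub>0 z \<le> 2 * \<epsilon>" for z
  proof -
    have "gdist c z \<le> 2 * rdist c z + h" by (rule gdist_upper(2)[OF c(1) that(1)])
    moreover have "rdist c z \<le> rdist x\<^sub>0 c + rdist x\<^sub>0 z"
      using rdist_triangle[OF inc[OF c(1)] x0 inc[OF that(1)]] by (simp add: rdist_commute)
    ultimately show ?thesis using c(2) that(2) \<delta>h \<epsilon> \<epsilon>0 by simp
  qed
  have U_le: "U x \<le> u c + 5 * K * \<epsilon>" if "x \<in> ?B" for x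
  proof -
    note xb = Bb[OF that]
    obtain z where z: "z \<in> V" "rdist x z \<le> \<epsilon>" "U x = u z" using Uz[OF xb(1)] by blast
    have "rdist x\<^sub>0 z \<le> 2 * \<epsilon>" using rdist_triangle[OF x0 xb(1) inc[OF z(1)]] xb(2) z(2) by simp
    then have "K * gdist c z \<le> K * (5 * \<epsilon>)" using gdist_far z(1) K by (intro mult_left_mono) auto
    then show ?thesis using lip[OF c(1) z(1)] z(3) by (simp add: algebra_simps)
  qed
  have U_ge: "u c - 4 * K * h \<le> U x" if "x \<in> ?B" for x
  proof -
    note xb = Bb[OF that]
    note xc = xb(1)
    \<comment> \<open>The vertex \<open>c\<close> need not lie in the ball about \<open>x\<close>. A vertex in that ball
      close to \<open>c\<close> is found near a point of a curve from \<open>x\<close> to \<open>x\<^sub>0\<close>, a little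
      before the end.\<close>
    define l where "l = \<epsilon> + \<delta> / 4"
    have "rdist x x\<^sub>0 < l" using xb(2) \<delta>_pos by (simp add: l_def rdist_commute)
    from rdist_path[OF xc x0 this] obtain p where p: "\<And>t. p t \<in> closure \<Omega>" 
      "\<And>t. 0 \<le> t \<Longrightarrow> t \<le> l \<Longrightarrow> rdist x (p t) \<le> t" "\<And>t. 0 \<le> t \<Longrightarrow> t \<le> l \<Longrightarrow> rdist (p t) x\<^sub>0 \<le> l - t" by metis
    define m where "m = p (\<epsilon> - 2 * \<delta>)"
    have m: "m \<in> closure \<Omega>" "rdist x m \<le> \<epsilon> - 2 * \<delta>" "rdist m x\<^sub>0 \<le> 9/4 * \<delta>"
      using p(1) p(2,3)[of "\<epsilon> - 2 * \<delta>"] \<delta>h \<epsilon> \<delta>_pos by (auto simp: m_def l_def)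
    obtain v where v: "v \<in> V" "rdist m v \<le> 5/4 * \<delta>" using near_vertex[OF m(1)] by metis
    have "rdist x v < \<epsilon>" using rdist_triangle[OF xc m(1) inc[OF v(1)]] m v \<delta>_pos by simp
    then have "u v \<le> U x" using Uge xc v by blast
    moreover have "rdist c v \<le> 5 * \<delta>"
      using rdist_triangle[OF inc[OF c(1)] x0 inc[OF v(1)]] rdist_triangle[OF x0 m(1) inc[OF v(1)]] m(3) v(2) c(2) \<delta>_pos
      by (simp add: rdist_commute)
    then have "gdist c v \<le> 4 * h" using gdist_upper(2)[OF c(1) v(1)] \<delta>h h_pos by linarith
    then have "K * gdist c v \<le> K * (4 * h)" using K by (intro mult_left_mono)
    then have "u c - u v \<le> 4 * K * h" using lip[OF c(1) v(1)] by (simp add: algebra_simps)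
    ultimately show ?thesis by simp
  qed
  have bdd: "bdd_above (U ` ?B)" "bdd_below (U ` ?B)"
    using U_le U_ge by (auto intro!: bdd_aboveI2 bdd_belowI2)
  have US: "U x \<le> S" if "x \<in> ?B" for x unfolding S_def by (rule cSUP_upper[OF that bdd(1)])
  have S_le: "S \<le> u c + 5 * K * \<epsilon>" unfolding S_def using x0B U_le by (intro cSUP_least) auto
  have I_ge: "u c - 4 * K * h \<le> I" unfolding I_def using x0B U_ge by (intro cINF_greatest) auto
  have S_ge: "u v \<le> S" if v: "v \<in> V" "rdist x\<^sub>0 v < 2 * \<epsilon>" for v
  proof -
    obtain l where l: "rdist x\<^sub>0 v < l" "l < 2 * \<epsilon>" using dense[OF v(2)] by blast
    have l0: "0 \<le> l" using l(1) rdist_nonneg[of x\<^sub>0 v] by linarith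
    \<comment> \<open>The midpoint of a curve from \<open>x\<^sub>0\<close> to \<open>v\<close> has both ends within
      \<open>\<epsilon>\<close>.\<close>
    from rdist_path[OF x0 inc[OF v(1)] l(1)] obtain p where p: "\<And>t. p t \<in> closure \<Omega>" 
      "\<And>t. 0 \<le> t \<Longrightarrow> t \<le> l \<Longrightarrow> rdist x\<^sub>0 (p t) \<le> t" "\<And>t. 0 \<le> t \<Longrightarrow> t \<le> l \<Longrightarrow> rdist (p t) v \<le> l - t" by metis
    have "rdist x\<^sub>0 (p (l/2)) < \<epsilon>" "rdist (p (l/2)) v < \<epsilon>" using p(2,3)[of "l/2"] l0 l(2) by simp_all
    then show ?thesis
      using US[of "p (l/2)"] Uge[OF p(1) v(1)] geo_cball_iff_bounds(2)[OF x0 p(1)] by (meson order.trans)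
  qed
  define E where "E = \<delta> * \<epsilon> / h + h + \<phi> h * \<epsilon> / h"
  have E: "0 \<le> \<delta> * \<epsilon> / h" "0 \<le> \<phi> h * \<epsilon> / h" "h \<le> E"
    using \<delta>_pos \<epsilon>0 h_pos \<phi>h by (auto simp: E_def)
  have C: "0 < 40 / t\<^sub>0" "0 < 2 * B / h\<^sub>0" using t0 B h0 by auto
  have main: "2 * U x\<^sub>0 - S - I \<le> K * (240 + 40 / t\<^sub>0 + 2 * B / h\<^sub>0) * E"
  proof -
    consider (coarse) "h\<^sub>0 \<le> h" | (wide) "\<epsilon> < 5 * h" | (fine) "h < h\<^sub>0" "5 * h \<le> \<epsilon>" by linarith
    then show ?thesis
    proof cases
      case coarse
      obtain z where z: "z \<in> V" "U x\<^sub>0 = u z" using Uz[OF x0] by blast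
      have "gdist c z \<le> 2 * B + h" using gdist_upper(2)[OF c(1) z(1)] B(2)[OF inc[OF c(1)] inc[OF z(1)]] by simp
      also have "2 * B \<le> 2 * B / h\<^sub>0 * h" using coarse h0 B by (simp add: field_simps)
      finally have "K * gdist c z \<le> K * (2 * B / h\<^sub>0 * h + h)" using K by (intro mult_left_mono) auto
      then have "U x\<^sub>0 - I \<le> K * (2 * B / h\<^sub>0 * h + h) + 4 * K * h"
        using lip[OF c(1) z(1)] z(2) I_ge by linarith
      also have "\<dots> = K * ((5 + 2 * B / h\<^sub>0) * h)" by (simp add: algebra_simps)
      also have "\<dots> \<le> K * ((240 + 40 / t\<^sub>0 + 2 * B / h\<^sub>0) * E)"
        using K E C h_pos by (intro mult_left_mono mult_mono) auto
      finally show ?thesis using US[OF x0B] by (simp add: mult.assoc)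
    next
      case wide
      have "2 * U x\<^sub>0 - S - I \<le> 5 * K * \<epsilon> + 4 * K * h" using US[OF x0B] S_le I_ge by linarith
      also have "\<dots> = K * (5 * \<epsilon> + 4 * h)" by (simp add: algebra_simps)
      also have "\<dots> \<le> K * (240 * h)" using wide K h_pos by (intro mult_left_mono) auto
      also have "\<dots> \<le> K * ((240 + 40 / t\<^sub>0 + 2 * B / h\<^sub>0) * E)"
        using K E C h_pos by (intro mult_left_mono mult_mono) auto
      finally show ?thesis by (simp add: mult.assoc)
    next
      case fine
      define p q where "p = 12 * \<phi> h / h" and "q = 4 * \<delta> / (t\<^sub>0 * h)"
      have p: "0 \<le> p" "p \<le> 3" using \<phi>h h_pos by (auto simp: p_def pos_divide_le_eq)
      have q: "0 \<le> q" "q \<le> 1" using \<delta>_pos \<delta>_le t0 h_pos by (auto simp: q_def)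
      \<comment> \<open>\<open>R\<close> bounds from below the graph distance from \<open>c\<close> to the vertices just
        outside \<open>A\<close>; the slope \<open>M\<close> lifts the cone to \<open>S\<close> there.\<close>
      define R where "R = (2 * \<epsilon> - 5 * h) / (1 + p)"
      have R: "0 < R" using fine(2) p h_pos by (simp add: R_def)
      have Sc: "u c \<le> S" using S_ge[OF c(1)] c(2) \<delta>h \<epsilon> h_pos by simp
      define M where "M = (S - u c) / R"
      have M: "0 \<le> M" using Sc R by (simp add: M_def)
      have MR: "M * R = S - u c" using R by (simp add: M_def)
      \<comment> \<open>The margin \<open>2 * h\<close> exceeds the geodesic length \<open>5/4 * h\<close> of an edge, so
        neighbours of \<open>A\<close> are still within \<open>2 * \<epsilon>\<close>, where \<open>S\<close> bounds
        \<open>u\<close>.\<close>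
      define A where "A = {y \<in> V. rdist x\<^sub>0 y < 2 * \<epsilon> - 2 * h} - {c}"
      have below: "u y \<le> u c + M * gdist c y" if y: "y \<in> A" for y
      proof (rule solution_below_cone[OF sol _ c(1) M _ y])
        show "A \<subseteq> V - O\<^sub>n - {c}" using far h_pos by (fastforce simp: A_def)
        fix y z assume yA: "y \<in> A" and zV: "z \<in> V" and zA: "z \<notin> A" and wyz: "0 < w y z"
        show "u z \<le> u c + M * gdist c z"
        proof (cases "z = c")
          case False
          have y: "y \<in> V" "rdist x\<^sub>0 y < 2 * \<epsilon> - 2 * h" using yA by (auto simp: A_def)
          have "norm (y - z) < h\<^sub>0" using norm_le_inverse_w(1)[OF wyz] fine by simp
          then have "rdist y z \<le> 5/4 * norm (y - z)"
            by (rule rdist_near[OF inc[OF y(1)] inc[OF zV] _ h0(2) \<phi>])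
          then have "rdist y z \<le> 5/4 * h" using norm_le_inverse_w(1)[OF wyz] by simp
          then have z2: "rdist x\<^sub>0 z < 2 * \<epsilon>" using rdist_triangle[OF x0 inc[OF y(1)] inc[OF zV]] y h_pos by simp
          have "2 * \<epsilon> - 2 * h \<le> rdist x\<^sub>0 z" using zA zV False by (auto simp: A_def)
          also have "\<dots> \<le> 5/4 * \<delta> + rdist c z" using rdist_triangle[OF x0 inc[OF c(1)] inc[OF zV]] c(2) by simp
          also have "rdist c z \<le> (1 + p) * gdist c z + 2 * h"
            unfolding p_def using gdist_lower[OF c(1) zV fine(1) h0(2) \<phi>] by simp
          finally have "R \<le> gdist c z" using p \<delta>h \<delta>_pos by (simp add: R_def pos_divide_le_eq mult.commute)
          then have "M * R \<le> M * gdist c z" using M by (rule mult_left_mono)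
          then have "S - u c \<le> M * gdist c z" using R by (simp add: M_def)
          then show ?thesis using S_ge[OF zV z2] by simp
        qed (use M in simp)
      qed
      obtain z where z: "z \<in> V" "rdist x\<^sub>0 z \<le> \<epsilon>" "U x\<^sub>0 = u z" using Uz[OF x0] by blast
      have uz: "u z \<le> u c + M * gdist c z"
      proof (cases "z = c")
        case False
        then show ?thesis using below z \<epsilon> by (auto simp: A_def)
      qed (use M in simp)
      have "rdist c z \<le> \<epsilon> + 2 * \<delta>"
        using rdist_triangle[OF inc[OF c(1)] x0 inc[OF z(1)]] c(2) z(2) \<delta>_pos by (simp add: rdist_commute)
      then have "(1 + q) * rdist c z \<le> (1 + q) * (\<epsilon> + 2 * \<delta>)" using q by (intro mult_left_mono) auto
      then have Dz: "gdist c z \<le> (1 + q) * (\<epsilon> + 2 * \<delta>) + h"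
        using gdist_upper(1)[OF c(1) z(1)] by (simp add: q_def)
      have key: "2 * gdist c z - R \<le> ((4 * p + 2 * q) + 21 * h / \<epsilon>) * R"
      proof -
        have "2 * gdist c z * (1 + p) \<le> 2 * ((1 + q) * (\<epsilon> + 2 * \<delta>) + h) * (1 + p)"
          using Dz p by (intro mult_right_mono) auto
        also have "\<dots> = 2 * \<epsilon> + 2 * (p + q + p * q) * \<epsilon> + 4 * ((1 + p) * (1 + q)) * \<delta> + 2 * (1 + p) * h"
          by (simp add: algebra_simps)
        also have "\<dots> \<le> 2 * \<epsilon> + 2 * (2 * p + q) * \<epsilon> + 4 * 8 * \<delta> + 2 * 4 * h"
        proof -
          have "p + q + p * q \<le> 2 * p + q" using mult_left_mono[OF q(2) p(1)] by simp
          then have "(p + q + p * q) * \<epsilon> \<le> (2 * p + q) * \<epsilon>" using \<epsilon>0 by (intro mult_right_mono) auto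
          moreover have "(1 + p) * (1 + q) \<le> 4 * 2" using p q by (intro mult_mono) auto
          then have "((1 + p) * (1 + q)) * \<delta> \<le> (4 * 2) * \<delta>" using \<delta>_pos by (intro mult_right_mono) auto
          moreover have "(1 + p) * h \<le> 4 * h" using p h_pos by (intro mult_right_mono) auto
          ultimately show ?thesis by linarith
        qed
        also have "\<dots> \<le> 2 * \<epsilon> + (4 * p + 2 * q) * \<epsilon> + 16 * h" using \<delta>h by (simp add: algebra_simps)
        finally have "2 * gdist c z * (1 + p) - (2 * \<epsilon> - 5 * h) \<le> (4 * p + 2 * q) * \<epsilon> + 21 * h" by simp
        also have "\<dots> = ((4 * p + 2 * q) + 21 * h / \<epsilon>) * \<epsilon>" using \<epsilon>0 by (simp add: field_simps)
        also have "\<dots> \<le> ((4 * p + 2 * q) + 21 * h / \<epsilon>) * (2 * \<epsilon> - 5 * h)"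
          using p q h_pos \<epsilon>0 fine(2) by (intro mult_left_mono) auto
        finally have "2 * gdist c z * (1 + p) - (2 * \<epsilon> - 5 * h)
            \<le> ((4 * p + 2 * q) + 21 * h / \<epsilon>) * (2 * \<epsilon> - 5 * h)" .
        moreover have "2 * \<epsilon> - 5 * h = R * (1 + p)" using p by (simp add: R_def)
        ultimately have "(2 * gdist c z - R) * (1 + p) \<le> (((4 * p + 2 * q) + 21 * h / \<epsilon>) * R) * (1 + p)"
          by (simp add: left_diff_distrib mult.assoc)
        then show ?thesis by (rule mult_right_le_imp_le) (use p in simp)
      qed
      have "2 * U x\<^sub>0 - S - u c \<le> 2 * M * gdist c z - (S - u c)" using uz z(3) by simp
      also have "\<dots> = M * (2 * gdist c z - R)" by (simp add: right_diff_distrib MR)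
      also have "\<dots> \<le> M * (((4 * p + 2 * q) + 21 * h / \<epsilon>) * R)" using key M by (rule mult_left_mono)
      also have "\<dots> = (S - u c) * ((4 * p + 2 * q) + 21 * h / \<epsilon>)" by (simp add: MR[symmetric])
      also have "\<dots> \<le> (5 * K * \<epsilon>) * ((4 * p + 2 * q) + 21 * h / \<epsilon>)"
        using S_le p q h_pos \<epsilon>0 by (intro mult_right_mono) auto
      also have "\<dots> = K * (20 * p * \<epsilon> + 10 * q * \<epsilon> + 105 * h)" using \<epsilon>0 by (simp add: algebra_simps)
      finally have "2 * U x\<^sub>0 - S - I \<le> K * (20 * p * \<epsilon> + 10 * q * \<epsilon> + 105 * h) + 4 * K * h"
        using I_ge by linarith
      also have "\<dots> = K * (240 * (\<phi> h * \<epsilon> / h) + 40 / t\<^sub>0 * (\<delta> * \<epsilon> / h) + 109 * h)"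
        using h_pos t0 by (simp add: p_def q_def algebra_simps)
      also have "\<dots> \<le> K * ((240 + 40 / t\<^sub>0 + 2 * B / h\<^sub>0) * E)"
      proof (rule mult_left_mono[OF _ K])
        let ?C = "240 + 40 / t\<^sub>0 + 2 * B / h\<^sub>0"
        have "240 * (\<phi> h * \<epsilon> / h) \<le> ?C * (\<phi> h * \<epsilon> / h)" "40 / t\<^sub>0 * (\<delta> * \<epsilon> / h) \<le> ?C * (\<delta> * \<epsilon> / h)"
          "109 * h \<le> ?C * h"
          using C E h_pos by (intro mult_right_mono; simp)+
        then show "240 * (\<phi> h * \<epsilon> / h) + 40 / t\<^sub>0 * (\<delta> * \<epsilon> / h) + 109 * h \<le> ?C * E"
          unfolding E_def distrib_left by linarith
      qed
      finally show ?thesis by (simp add: mult.assoc)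
    qed
  qed
  have "- nonlocal_inf_laplacian \<Omega> \<epsilon> U x\<^sub>0 = (2 * U x\<^sub>0 - S - I) / \<epsilon>\<^sup>2"
    by (simp add: nonlocal_inf_laplacian_def S_def I_def diff_divide_distrib add_divide_distrib)
  also have "\<dots> \<le> K * (240 + 40 / t\<^sub>0 + 2 * B / h\<^sub>0) * E / \<epsilon>\<^sup>2"
    using main by (intro divide_right_mono) auto
  also have "\<dots> = K * (240 + 40 / t\<^sub>0 + 2 * B / h\<^sub>0) * (E / \<epsilon>\<^sup>2)" by simp
  also have "E / \<epsilon>\<^sup>2 = \<delta> / (h * \<epsilon>) + h / \<epsilon>\<^sup>2 + \<phi> h / (h * \<epsilon>)"
    using \<epsilon>0 h_pos by (simp add: E_def field_simps power2_eq_square)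
  finally show ?thesis by (simp add: K_def U_def)
qed

end

section \<open>Both inequalities\<close>

lemma hausdorff_dist_approx:
  fixes A B :: "'a::euclidean_space set"
  assumes A: "bounded A" and B: "bounded B" "B \<noteq> {}" and d: "hausdorff_dist A B < d" and x: "x \<in> A"
  shows "\<exists>y\<in>B. norm (x - y) < d"
proof -
  obtain y\<^sub>0 where y0: "y\<^sub>0 \<in> B" using B by auto
  obtain a where a: "\<And>x. x \<in> A \<Longrightarrow> norm x \<le> a" using A by (auto simp: bounded_iff)
  have bel: "bdd_below ((\<lambda>y. norm (x - y)) ` B)" for x by (rule bdd_belowI2[where m = 0]) auto
  have "bdd_above ((\<lambda>x. INF y\<in>B. norm (x - y)) ` A)"
  proof (rule bdd_aboveI2)
    fix x assume "x \<in> A"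
    have "(INF y\<in>B. norm (x - y)) \<le> norm (x - y\<^sub>0)" by (rule cINF_lower[OF bel y0])
    also have "\<dots> \<le> a + norm y\<^sub>0" using norm_triangle_ineq4[of x y\<^sub>0] a[OF \<open>x \<in> A\<close>] by simp
    finally show "(INF y\<in>B. norm (x - y)) \<le> a + norm y\<^sub>0" .
  qed
  then have "(INF y\<in>B. norm (x - y)) \<le> (SUP x\<in>A. INF y\<in>B. norm (x - y))" by (rule cSUP_upper[OF x])
  also have "\<dots> < d" using d by (simp add: hausdorff_dist_def)
  finally show ?thesis using cINF_less_iff[OF B(2) bel] by blast
qed

lemma hausdorff_dist_commute: "hausdorff_dist A B = hausdorff_dist B A"
  by (simp add: hausdorff_dist_def norm_minus_commute max.commute)

theorem theorem5p13:
  fixes \<Omega> :: "'a::euclidean_space set"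
    and \<phi> \<eta> :: "real \<Rightarrow> real"
    and r\<^sub>\<Omega> t\<^sub>0 :: real
  assumes "open \<Omega>" and "bounded \<Omega>" and "connected \<Omega>" and "\<Omega> \<noteq> {}"
    and "domain_assumption \<Omega> \<phi> r\<^sub>\<Omega>"
    and "kernel_assumption \<eta> t\<^sub>0"
  shows "\<exists>C>0.
    \<forall>(O\<^sub>0 :: 'a set) (\<Omega>s :: nat \<Rightarrow> 'a set) (Os :: nat \<Rightarrow> 'a set).
      O\<^sub>0 \<noteq> {} \<and> closed O\<^sub>0 \<and> O\<^sub>0 \<subseteq> closure \<Omega> \<and>
      (\<forall>n. finite (\<Omega>s n) \<and> \<Omega>s n \<subseteq> closure \<Omega> \<and> Os n \<noteq> {} \<and> Os n \<subseteq> \<Omega>s n) \<longrightarrow>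
      (\<forall>(n::nat) (\<delta>::real) (h::real) (\<epsilon>::real) (g :: 'a \<Rightarrow> real) (u :: 'a \<Rightarrow> real).
         \<delta> = resolution \<Omega> O\<^sub>0 (\<Omega>s n) (Os n) \<and> 0 < \<delta> \<and> 0 < h \<and> 0 < \<epsilon> \<and>
         scaling_assumption \<phi> r\<^sub>\<Omega> t\<^sub>0 \<delta> h \<epsilon> \<and>
         solves_graph_inf_laplace \<eta> h (\<Omega>s n) (Os n) g u \<longrightarrow>
         (\<forall>x\<^sub>0 \<in> closure \<Omega>. ennreal (2 * \<epsilon> + 3 * \<delta>) < geo_setdist \<Omega> x\<^sub>0 O\<^sub>0 \<longrightarrow>
            - nonlocal_inf_laplacian \<Omega> \<epsilon> (upper_ext \<Omega> (\<Omega>s n) \<epsilon> u) x\<^sub>0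
              \<le> graph_Lip \<eta> h (\<Omega>s n) (Os n) g * C *
                  (\<delta> / (h * \<epsilon>) + h / \<epsilon>\<^sup>2 + \<phi> h / (h * \<epsilon>)) \<and>
            - nonlocal_inf_laplacian \<Omega> \<epsilon> (lower_ext \<Omega> (\<Omega>s n) \<epsilon> u) x\<^sub>0
              \<ge> - graph_Lip \<eta> h (\<Omega>s n) (Os n) g * C *
                  (\<delta> / (h * \<epsilon>) + h / \<epsilon>\<^sup>2 + \<phi> h / (h * \<epsilon>))))"
proof -
  interpret geo_domain \<Omega> \<phi> r\<^sub>\<Omega> by unfold_locales (use assms in auto)
  have t0: "0 < t\<^sub>0" "t\<^sub>0 \<le> 1" using assms(6) by (auto simp: kernel_assumption_def)
  obtain h\<^sub>0 where h0: "0 < h\<^sub>0" "h\<^sub>0 \<le> r\<^sub>\<Omega>" "\<And>s. 0 < s \<Longrightarrow> s \<le> h\<^sub>0 \<Longrightarrow> \<phi> s \<le> s / 4"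
    using phi_small[of "1/4"] by auto
  obtain B where B: "0 < B" "\<And>x y. x \<in> closure \<Omega> \<Longrightarrow> y \<in> closure \<Omega> \<Longrightarrow> rdist x y \<le> B"
    using rdist_bounded by metis
  define C where "C = 240 + 40 / t\<^sub>0 + 2 * B / h\<^sub>0"
  have C: "0 < C" using t0 B h0 by (simp add: C_def add_pos_pos)
  have estimate: "- nonlocal_inf_laplacian \<Omega> \<epsilon> (upper_ext \<Omega> V \<epsilon> u) x\<^sub>0
              \<le> graph_Lip \<eta> h V O\<^sub>n g * C * (\<delta> / (h * \<epsilon>) + h / \<epsilon>\<^sup>2 + \<phi> h / (h * \<epsilon>)) \<and>
            - nonlocal_inf_laplacian \<Omega> \<epsilon> (lower_ext \<Omega> V \<epsilon> u) x\<^sub>0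
              \<ge> - graph_Lip \<eta> h V O\<^sub>n g * C * (\<delta> / (h * \<epsilon>) + h / \<epsilon>\<^sup>2 + \<phi> h / (h * \<epsilon>))"
    if O0: "O\<^sub>0 \<noteq> {}" "O\<^sub>0 \<subseteq> closure \<Omega>"
      and V: "finite V" "V \<subseteq> closure \<Omega>" "O\<^sub>n \<noteq> {}" "O\<^sub>n \<subseteq> V"
      and \<delta>: "\<delta> = resolution \<Omega> O\<^sub>0 V O\<^sub>n" "0 < \<delta>" and h: "0 < h" and \<epsilon>: "0 < \<epsilon>"
      and scale: "scaling_assumption \<phi> r\<^sub>\<Omega> t\<^sub>0 \<delta> h \<epsilon>"
      and sol: "solves_graph_inf_laplace \<eta> h V O\<^sub>n g u"
      and x0: "x\<^sub>0 \<in> closure \<Omega>" and far: "ennreal (2 * \<epsilon> + 3 * \<delta>) < geo_setdist \<Omega> x\<^sub>0 O\<^sub>0"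
    for O\<^sub>0 V O\<^sub>n :: "'a set" and \<delta> h \<epsilon> :: real and g u x\<^sub>0
  proof -
    define \<sigma> where "\<sigma> = sigma_phi \<phi> h"
    have bdd: "bdd_above ((\<lambda>s. \<phi> s / s) ` {0<..h})" and hr: "h \<le> r\<^sub>\<Omega>" and he: "h / \<epsilon> < 1 / 2"
      and sc: "\<sigma> + \<delta> / h \<le> t\<^sub>0 / (4 + 2 * \<sigma>) * (1 - 2 * (h / \<epsilon>))"
      using scale by (auto simp: scaling_assumption_def \<sigma>_def)
    have \<sigma>: "\<phi> s / s \<le> \<sigma>" if "0 < s" "s \<le> h" for s
      unfolding \<sigma>_def sigma_phi_def using that by (intro cSUP_upper bdd) auto
    have \<sigma>0: "0 \<le> \<sigma>" using \<sigma>[of h] phi_nonneg[of h] h by (auto intro: order.trans[rotated])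
    have he2: "2 * h < \<epsilon>" using he \<epsilon> by (simp add: field_simps)
    \<comment> \<open>The scaling assumption bounds both \<open>\<sigma>\<close> and \<open>\<delta> / h\<close> by
      \<open>t\<^sub>0 / 4\<close>, which is at most \<open>1 / 4\<close>.\<close>
    have "t\<^sub>0 / (4 + 2 * \<sigma>) * (1 - 2 * (h / \<epsilon>)) \<le> t\<^sub>0 / 4 * 1"
      using t0 \<sigma>0 h \<epsilon> he by (intro mult_mono divide_left_mono) auto
    then have sum: "\<sigma> + \<delta> / h \<le> t\<^sub>0 / 4" using sc by linarith
    have \<delta>h0: "0 < \<delta> / h" using \<delta> h by simp
    have "\<delta> / h \<le> t\<^sub>0 / 4" using sum \<sigma>0 by linarith
    then have \<delta>h: "4 * \<delta> \<le> t\<^sub>0 * h" using h by (simp add: field_simps)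
    have \<phi>4: "\<phi> s \<le> s / 4" if "0 < s" "s \<le> h" for s
    proof -
      have "\<phi> s / s \<le> 1 / 4" using \<sigma>[OF that] sum \<delta>h0 t0 by linarith
      then show ?thesis using that by (simp add: field_simps)
    qed
    have res1: "hausdorff_dist V (closure \<Omega>) \<le> \<delta>" and res2: "hausdorff_dist O\<^sub>n O\<^sub>0 \<le> \<delta>"
      unfolding \<delta>(1) resolution_def by auto
    have bcl: "bounded (closure \<Omega>)" using assms(2) by (rule bounded_closure)
    have bV: "bounded V" "bounded O\<^sub>n" "bounded O\<^sub>0"
      using bcl V(2,4) O0(2) by (meson bounded_subset order.trans)+
    have resolves: "\<exists>v\<in>V. norm (x - v) \<le> \<delta>" if x: "x \<in> closure \<Omega>" for x
    proof -
      have Vne: "V \<noteq> {}" using V by auto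
      define m where "m = Min ((\<lambda>v. norm (x - v)) ` V)"
      have "m \<in> (\<lambda>v. norm (x - v)) ` V" unfolding m_def using V(1) Vne by (intro Min_in) auto
      then obtain v where v: "v \<in> V" "norm (x - v) = m" by auto
      have "m \<le> \<delta>"
      proof (rule field_le_epsilon)
        fix e :: real assume "0 < e"
        then have "hausdorff_dist (closure \<Omega>) V < \<delta> + e"
          using res1 by (simp add: hausdorff_dist_commute)
        from hausdorff_dist_approx[OF bcl bV(1) Vne this x] obtain v' where
          "v' \<in> V" "norm (x - v') < \<delta> + e" by blast
        moreover have "m \<le> norm (x - v')" unfolding m_def using V(1) \<open>v' \<in> V\<close> by (intro Min_le) auto
        ultimately show "m \<le> \<delta> + e" by simp
      qed
      then show ?thesis using v by auto
    qed
    interpret approximating_graph \<Omega> \<phi> r\<^sub>\<Omega> \<eta> t\<^sub>0 h V \<delta>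
      by unfold_locales (use assms(6) h V \<delta>(2) hr \<phi>4 \<delta>h resolves in auto)
    have far_labels: "2 * \<epsilon> < rdist x\<^sub>0 a" if a: "a \<in> O\<^sub>n" for a
    proof -
      have ac: "a \<in> closure \<Omega>" using a V by auto
      have "hausdorff_dist O\<^sub>n O\<^sub>0 < 3/2 * \<delta>" using res2 \<delta>(2) by linarith
      from hausdorff_dist_approx[OF bV(2,3) O0(1) this a] obtain b where
        b: "b \<in> O\<^sub>0" "norm (a - b) < 3/2 * \<delta>" by blast
      have bc: "b \<in> closure \<Omega>" using b O0 by auto
      have "rdist a b \<le> 5/4 * norm (a - b)"
        using b(2) \<delta>_le_h \<delta>(2) by (intro rdist_near[OF ac bc _ hr \<phi>4]) auto
      then have ab: "rdist a b < 3 * \<delta>" using b(2) \<delta>(2) by linarith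
      have "geo_setdist \<Omega> x\<^sub>0 O\<^sub>0 \<le> geo_dist \<Omega> x\<^sub>0 b"
        unfolding geo_setdist_def by (rule INF_lower[OF b(1)])
      then have "\<not> geo_dist \<Omega> x\<^sub>0 b \<le> ennreal (2 * \<epsilon> + 3 * \<delta>)" using far by (meson leD order.trans)
      then have "2 * \<epsilon> + 3 * \<delta> < rdist x\<^sub>0 b"
        using rdist_le_iff[OF x0 bc, of "2 * \<epsilon> + 3 * \<delta>"] \<epsilon> \<delta>(2) by simp
      then show ?thesis using rdist_triangle[OF x0 ac bc] ab by simp
    qed
    define R where "R = graph_Lip \<eta> h V O\<^sub>n g * C * (\<delta> / (h * \<epsilon>) + h / \<epsilon>\<^sup>2 + \<phi> h / (h * \<epsilon>))"
    have up: "- nonlocal_inf_laplacian \<Omega> \<epsilon> (upper_ext \<Omega> V \<epsilon> u) x\<^sub>0 \<le> R"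
      unfolding R_def C_def
      by (rule one_sided_estimate[OF sol V(4,3) x0 far_labels he2 h0 B])
    have "- nonlocal_inf_laplacian \<Omega> \<epsilon> (upper_ext \<Omega> V \<epsilon> (\<lambda>x. - u x)) x\<^sub>0
        \<le> graph_Lip \<eta> h V O\<^sub>n (\<lambda>x. - g x) * C * (\<delta> / (h * \<epsilon>) + h / \<epsilon>\<^sup>2 + \<phi> h / (h * \<epsilon>))"
      unfolding C_def
      by (rule one_sided_estimate[OF solution_uminus[OF sol V(4)] V(4,3) x0 far_labels he2 h0 B])
    also have "graph_Lip \<eta> h V O\<^sub>n (\<lambda>x. - g x) = graph_Lip \<eta> h V O\<^sub>n g"
      unfolding graph_Lip_def by (simp add: abs_minus_commute)
    also have "upper_ext \<Omega> V \<epsilon> (\<lambda>x. - u x) = (\<lambda>x. - lower_ext \<Omega> V \<epsilon> u x)"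
      unfolding upper_ext_def lower_ext_def by (simp add: Inf_real_def image_image)
    also have "nonlocal_inf_laplacian \<Omega> \<epsilon> (\<lambda>x. - lower_ext \<Omega> V \<epsilon> u x) x\<^sub>0
        = - nonlocal_inf_laplacian \<Omega> \<epsilon> (lower_ext \<Omega> V \<epsilon> u) x\<^sub>0"
      unfolding nonlocal_inf_laplacian_def by (simp add: Inf_real_def image_image algebra_simps)
    finally show ?thesis using up by (simp add: R_def)
  qed
  show ?thesis
  proof (rule exI[of _ C], rule conjI[OF C], intro allI impI ballI, elim conjE, goal_cases)
    case (1 O\<^sub>0 \<Omega>s Os n \<delta> h \<epsilon> g u x\<^sub>0)
    then have V: "finite (\<Omega>s n)" "\<Omega>s n \<subseteq> closure \<Omega>" "Os n \<noteq> {}" "Os n \<subseteq> \<Omega>s n" by simp_all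
    show ?case by (rule estimate[of O\<^sub>0 "\<Omega>s n" "Os n"]) (fact 1 V)+
  qed
qed

end
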